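(* For every even integer $\nu\ge 6$, $$\varepsilon(\nu,2)=\begin{cases} 15, & \text{if } \nu=6,\\ 16, & \text{if } \nu=8,\\ 19, & \text{if } \nu=10,\\ 20, & \text{if } \nu=12,\\ 3\nu/2, & \text{if } \nu\ge 14.\end{cases}$$
   Context: All graphs are finite, connected and simple. A connected graph $G$ on $\nu$ vertices is $k$-extendable, where $k$ is an integer with $0\le k\le (\nu-2)/2$, if $G$ contains a matching of size $k$ and every matching of size $k$ in $G$ is contained in a perfect matching of $G$. For an integer $k\ge 1$ and an even integer $\nu\ge 2k+2$, $\varepsilon(\nu,k)$ denotes the minimum number of edges of a $k$-extendable non-bipartite graph on $\nu$ vertices. *)

theory Defs
  imports "HOL-Library.Disjoint_Sets" "HOL-Library.Extended_Nat"
begin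

text \<open>A graph is given by its vertex set and its set of edges, the edges being two-element
  sets of vertices.\<close>

definition simple_graph :: "'a set \<Rightarrow> 'a set set \<Rightarrow> bool" where
  "simple_graph V E \<longleftrightarrow> finite V \<and> (\<forall>e\<in>E. e \<subseteq> V \<and> card e = 2)"

definition connected_graph :: "'a set \<Rightarrow> 'a set set \<Rightarrow> bool" where
  "connected_graph V E \<longleftrightarrow>
     simple_graph V E \<and> V \<noteq> {} \<and> (\<forall>u\<in>V. \<forall>v\<in>V. (u, v) \<in> {(x, y). {x, y} \<in> E}\<^sup>*)"

definition bipartite :: "'a set \<Rightarrow> 'a set set \<Rightarrow> bool" where
  "bipartite V E \<longleftrightarrow>
     (\<exists>A B. A \<union> B = V \<and> A \<inter> B = {} \<and> (\<forall>e\<in>E. \<exists>a\<in>A. \<exists>b\<in>B. e = {a, b}))"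

definition matching :: "'a set set \<Rightarrow> 'a set set \<Rightarrow> bool" where
  "matching E M \<longleftrightarrow> M \<subseteq> E \<and> disjoint M"

definition perfect_matching :: "'a set \<Rightarrow> 'a set set \<Rightarrow> 'a set set \<Rightarrow> bool" where
  "perfect_matching V E M \<longleftrightarrow> matching E M \<and> \<Union>M = V"

text \<open>The bound \<open>k \<le> (\<nu> - 2) / 2\<close> is written without truncated subtraction.\<close>

definition extendable :: "nat \<Rightarrow> 'a set \<Rightarrow> 'a set set \<Rightarrow> bool" where
  "extendable k V E \<longleftrightarrow>
     connected_graph V E \<and> 2 * k + 2 \<le> card V \<and>
     (\<exists>M. matching E M \<and> card M = k) \<and>
     (\<forall>M. matching E M \<and> card M = k \<longrightarrow> (\<exists>P. perfect_matching V E P \<and> M \<subseteq> P))"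

text \<open>Every finite graph is isomorphic to one whose vertices are natural numbers, so letting the
  vertex set range over sets of naturals loses nothing. The minimum is an infimum in the extended
  naturals: it is \<open>\<infinity>\<close> if there is no such graph, and a finite value is attained.\<close>

definition min_edges :: "nat \<Rightarrow> nat \<Rightarrow> enat" where
  "min_edges \<nu> k =
     Inf {enat (card E) | V E :: nat set set. card V = \<nu> \<and> extendable k V E \<and> \<not> bipartite V E}"

end

theory Submission
  imports Defs
begin

text \<open>
  Lower bounds. In a 2-extendable graph every vertex has degree at least 3, and the neighbours of a
  vertex of degree exactly 3 are independent. If such a graph is not bipartite and has \<open>\<nu>\<close> vertices,
  its independent sets have at most \<open>\<nu> / 2 - 2\<close> elements: the complement \<open>T\<close> of an independent set \<open>I\<close>
  with \<open>|T| = |I| + 2\<close> would contain exactly one edge of each perfect matching, so two disjoint edges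
  can neither both lie in \<open>T\<close> nor join the ends of an edge of \<open>T\<close> to \<open>I\<close>, which leaves only
  bipartite graphs. The four exceptional values then become Ramsey type statements on the minimum
  number of edges of graphs with independence number at most 1, 2, 3 or 4.

  Upper bounds. For \<open>\<nu> \<le> 18\<close> explicit graphs are given together with a list of perfect matchings
  covering all pairs of disjoint edges. Larger cubic graphs arise from those on 16 and 18 vertices by
  inserting two rungs, hence 4 vertices, into a chordless 4-cycle, as if it were a piece of a ladder.
\<close>

section \<open>Degrees, independent sets and matchings\<close>

text \<open>The threshold 14 comes from the bound on independent sets, which makes vertices of
  degree 3 costly while it is small. On 6 and 8 vertices it excludes them altogether. On 10 and 12
  vertices, deleting a cubic vertex and its three neighbours leaves 6 or 8 vertices with
  independence number at most 2 or 3, hence many edges, and independence of the three neighbours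
  makes the count of deleted edges exact. On 14 vertices a cubic example exists, so the degree bound
  is attained.

  The enlargement must respect parity. A rail becomes a path of length 3, so a 2-colouring of the
  new graph gives one of the old, and a rail used by a matching can be replaced by the two outer
  edges of its path. A single rung would make that path even and spoil both arguments. Hence the
  step of 4 and the need for two starting graphs; the graph on 14 vertices given below has no
  4-cycle and cannot be one of them.\<close>

definition nbrs :: "'a set set \<Rightarrow> 'a \<Rightarrow> 'a set" where
  "nbrs E v = {w. {v, w} \<in> E}"

definition induced :: "'a set set \<Rightarrow> 'a set \<Rightarrow> 'a set set" where
  "induced E X = {e \<in> E. e \<subseteq> X}"

definition indep :: "'a set set \<Rightarrow> 'a set \<Rightarrow> bool" where
  "indep E I \<longleftrightarrow> (\<forall>u\<in>I. \<forall>w\<in>I. {u, w} \<notin> E)"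

text \<open>Extendability is used in this form: deleting the ends of two disjoint edges leaves a
  matchable set. Perfect matchings are then built up edge by edge.\<close>

definition matchable :: "'a set set \<Rightarrow> 'a set \<Rightarrow> bool" where
  "matchable E X \<longleftrightarrow> (\<exists>P. perfect_matching X E P)"

lemma in_nbrs [simp]: "w \<in> nbrs E v \<longleftrightarrow> {v, w} \<in> E"
  by (simp add: nbrs_def)

lemma indep_subset: "indep E I \<Longrightarrow> J \<subseteq> I \<Longrightarrow> indep E J"
  unfolding indep_def by blast

lemma matchable_insert:
  assumes "matchable E X" "{u, v} \<in> E" "u \<notin> X" "v \<notin> X"
  shows "matchable E (insert u (insert v X))"
proof -
  obtain P where P: "P \<subseteq> E" "disjoint P" "\<Union>P = X"
    using assms(1) by (auto simp: matchable_def perfect_matching_def matching_def)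
  have "disjoint (insert {u, v} P)"
    using P assms(3,4) by (auto simp: disjoint_def pairwise_insert disjnt_def)
  then have "perfect_matching (insert u (insert v X)) E (insert {u, v} P)"
    using P assms(2) by (auto simp: perfect_matching_def matching_def)
  then show ?thesis by (auto simp: matchable_def)
qed

lemma perfect_matching_remove:
  assumes "perfect_matching X E P" "e \<in> P"
  shows "perfect_matching (X - e) E (P - {e})"
proof -
  have P: "P \<subseteq> E" "disjoint P" "\<Union>P = X"
    using assms(1) by (auto simp: perfect_matching_def matching_def)
  have "\<Union>(P - {e}) = X - e"
    using P(2,3) assms(2) by (fastforce simp: disjoint_def)
  moreover have "disjoint (P - {e})"
    using P(2) by (auto simp: disjoint_def)
  ultimately show ?thesis
    using P(1) by (auto simp: perfect_matching_def matching_def)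
qed

text \<open>A matching of size 2 is a pair of disjoint edges, distinct because edges are nonempty; a
  perfect matching of the other vertices completes it.\<close>

lemma extendableI:
  assumes conn: "connected_graph V E" and card: "6 \<le> card V"
    and ex: "e0 \<in> E" "f0 \<in> E" "e0 \<inter> f0 = {}"
    and ext: "\<And>e f. e \<in> E \<Longrightarrow> f \<in> E \<Longrightarrow> e \<inter> f = {} \<Longrightarrow> matchable E (V - e - f)"
  shows "extendable 2 V E"
proof -
  have sg: "e \<subseteq> V" "card e = 2" if "e \<in> E" for e
    using conn that by (auto simp: connected_graph_def simple_graph_def)
  have ne: "e \<noteq> {}" if "e \<in> E" for e using sg[OF that] by auto
  have 1: "\<exists>M. matching E M \<and> card M = 2"
  proof (intro exI conjI)
    show "matching E {e0, f0}"
      using ex by (auto simp: matching_def disjoint_def)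
    have "e0 \<noteq> f0" using ex ne by auto
    then show "card {e0, f0} = 2" by simp
  qed
  have 2: "\<exists>P. perfect_matching V E P \<and> M \<subseteq> P" if M: "matching E M" "card M = 2" for M
  proof -
    obtain e f where ef: "M = {e, f}" "e \<noteq> f" using M(2) by (auto simp: card_2_iff)
    have efE: "e \<in> E" "f \<in> E" using M(1) ef by (auto simp: matching_def)
    have dis: "e \<inter> f = {}" using M(1) ef by (auto simp: matching_def disjoint_def)
    obtain P where P: "P \<subseteq> E" "disjoint P" "\<Union>P = V - e - f"
      using ext[OF efE dis] by (auto simp: matchable_def perfect_matching_def matching_def)
    have "disjoint (insert e (insert f P))"
      using P dis by (auto simp: disjoint_def pairwise_insert disjnt_def)
    moreover have "\<Union>(insert e (insert f P)) = V"
      using P(3) sg efE by auto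
    ultimately have "perfect_matching V E (insert e (insert f P))"
      using P efE by (auto simp: perfect_matching_def matching_def)
    then show ?thesis using ef by blast
  qed
  show ?thesis unfolding extendable_def using conn card 1 2 by auto
qed

section \<open>Perfect matchings and edge counts in simple graphs\<close>

locale sgraph =
  fixes V :: "'a set" and E :: "'a set set"
  assumes simple: "simple_graph V E"
begin

lemma finV [simp]: "finite V"
  using simple by (auto simp: simple_graph_def)

lemma edge_sub: "e \<in> E \<Longrightarrow> e \<subseteq> V"
  using simple by (auto simp: simple_graph_def)

lemma edge_card: "e \<in> E \<Longrightarrow> card e = 2"
  using simple by (auto simp: simple_graph_def)

lemma finE [simp]: "finite E"
proof (rule finite_subset)
  show "E \<subseteq> Pow V" using edge_sub by auto
qed simp

lemma no_loop [simp]: "{v} \<notin> E"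
  using edge_card by force

lemma edgeD: "{u, v} \<in> E \<Longrightarrow> u \<in> V \<and> v \<in> V \<and> u \<noteq> v"
  using edge_sub[of "{u, v}"] edge_card[of "{u, v}"] by (cases "u = v") auto

lemma edge_pair:
  assumes "e \<in> E"
  obtains u v where "e = {u, v}"
  using edge_card[OF assms] by (auto simp: card_2_iff)

lemma nbrs_sub: "nbrs E v \<subseteq> V"
  using edgeD by auto

lemma fin_nbrs [simp]: "finite (nbrs E v)"
  by (rule finite_subset[OF nbrs_sub]) simp

lemma not_self_nbr [simp]: "v \<notin> nbrs E v"
  by simp

text \<open>A perfect matching is an involution sending each vertex to a neighbour. Injectivity of
  \<open>p\<close> turns questions about matchings into comparisons of cardinalities.\<close>

lemma perfect_matching_partner:
  assumes "perfect_matching X E P"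
  obtains p where "\<And>v. v \<in> X \<Longrightarrow> {v, p v} \<in> P" "\<And>v. v \<in> X \<Longrightarrow> p v \<in> X"
    "\<And>v. v \<in> X \<Longrightarrow> p (p v) = v" "\<And>u v. {u, v} \<in> P \<Longrightarrow> p u = v" "inj_on p X"
    "\<And>v. v \<in> X \<Longrightarrow> {v, p v} \<in> E"
proof -
  have P: "P \<subseteq> E" "disjoint P" "\<Union>P = X"
    using assms by (auto simp: perfect_matching_def matching_def)
  have "\<forall>v\<in>X. \<exists>w. {v, w} \<in> P"
  proof
    fix v assume "v \<in> X"
    then obtain e where e: "e \<in> P" "v \<in> e" using P(3) by auto
    then have "e \<in> E" using P(1) by auto
    then obtain a b where "e = {a, b}" by (rule edge_pair)
    then show "\<exists>w. {v, w} \<in> P" using e by (auto simp: insert_commute)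
  qed
  then obtain p where p: "\<And>v. v \<in> X \<Longrightarrow> {v, p v} \<in> P" by metis
  have uniq: "w = w'" if "{v, w} \<in> P" "{v, w'} \<in> P" for v w w'
  proof -
    have "{v, w} \<inter> {v, w'} \<noteq> {}" by simp
    then have "{v, w} = {v, w'}" using disjointD[OF P(2) that] by blast
    then show ?thesis by (auto simp: doubleton_eq_iff)
  qed
  have pX: "p v \<in> X" if "v \<in> X" for v using p[OF that] P(3) by auto
  have pp: "p (p v) = v" if "v \<in> X" for v
    using uniq[of "p v" v "p (p v)"] p[OF that] p[OF pX[OF that]] by (simp add: insert_commute)
  have puv: "p u = v" if "{u, v} \<in> P" for u v
  proof -
    have "u \<in> X" using that P(3) by auto
    then show ?thesis using uniq[OF that p] by simp
  qed
  have "inj_on p X" by (metis inj_on_inverseI pp)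
  moreover have "{v, p v} \<in> E" if "v \<in> X" for v using p[OF that] P(1) by auto
  ultimately show thesis using that p pX pp puv by blast
qed

lemma induced_subset: "induced E X \<subseteq> E"
  by (auto simp: induced_def)

lemma fin_induced [simp]: "finite (induced E X)"
  by (rule finite_subset[OF induced_subset]) simp

lemma induced_V [simp]: "induced E V = E"
  using edge_sub by (auto simp: induced_def)

lemma induced_remove_isolated:
  assumes "nbrs E v \<inter> X = {}"
  shows "induced E (X - {v}) = induced E X"
proof -
  have "v \<notin> e" if e: "e \<in> E" "e \<subseteq> X" for e
  proof
    assume "v \<in> e"
    obtain a b where "e = {a, b}" by (rule edge_pair[OF e(1)])
    then have "{v, a} \<in> E \<and> a \<in> X \<or> {v, b} \<in> E \<and> b \<in> X"
      using \<open>v \<in> e\<close> e by (auto simp: insert_commute)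
    then show False using assms by auto
  qed
  then show ?thesis by (auto simp: induced_def)
qed

text \<open>Independence of \<open>N\<close> makes the stars \<open>F w\<close> disjoint: an edge
  meeting \<open>N\<close> has only one end there, so none is counted twice.\<close>

lemma card_induced_split:
  assumes "N \<subseteq> X" "X \<subseteq> V" "indep E N"
  shows "card (induced E X) = card (induced E (X - N)) + (\<Sum>w\<in>N. card (nbrs E w \<inter> X))"
proof -
  define F where "F w = (\<lambda>u. {w, u}) ` (nbrs E w \<inter> X)" for w
  have finN: "finite N" using assms finite_subset[OF _ finV] by auto
  have cF: "card (F w) = card (nbrs E w \<inter> X)" for w
    unfolding F_def by (rule card_image) (auto simp: inj_on_def doubleton_eq_iff)
  have "induced E X = induced E (X - N) \<union> (\<Union>w\<in>N. F w)"
  proof (intro equalityI subsetI)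
    fix e assume e: "e \<in> induced E X"
    show "e \<in> induced E (X - N) \<union> (\<Union>w\<in>N. F w)"
    proof (cases "e \<inter> N = {}")
      case True
      then show ?thesis using e by (auto simp: induced_def)
    next
      case False
      then obtain w where w: "w \<in> e" "w \<in> N" by auto
      have "e \<in> E" using e by (auto simp: induced_def)
      then obtain a b where "e = {a, b}" by (rule edge_pair)
      then have "e \<in> F w" using w e by (auto simp: induced_def F_def insert_commute)
      then show ?thesis using w by auto
    qed
  next
    fix e assume "e \<in> induced E (X - N) \<union> (\<Union>w\<in>N. F w)"
    then show "e \<in> induced E X" using assms by (auto simp: induced_def F_def)
  qed
  moreover have "induced E (X - N) \<inter> (\<Union>w\<in>N. F w) = {}"
    by (auto simp: induced_def F_def)
  moreover have "card (\<Union>w\<in>N. F w) = (\<Sum>w\<in>N. card (F w))"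
  proof (rule card_UN_disjoint)
    show "\<forall>i\<in>N. \<forall>j\<in>N. i \<noteq> j \<longrightarrow> F i \<inter> F j = {}"
      using assms(3) by (auto simp: F_def indep_def doubleton_eq_iff)
  qed (use finN in \<open>auto simp: F_def\<close>)
  moreover have "finite (\<Union>w\<in>N. F w)" using finN by (auto simp: F_def)
  ultimately show ?thesis by (simp add: card_Un_disjoint cF)
qed

text \<open>Once its neighbours are gone \<open>v\<close> is isolated, so deleting it as well loses
  no edge.\<close>

lemma card_induced_split_nbrs:
  assumes "X \<subseteq> V" "indep E (nbrs E v \<inter> X)"
  shows "card (induced E X) = card (induced E (X - insert v (nbrs E v)))
    + (\<Sum>w\<in>nbrs E v \<inter> X. card (nbrs E w \<inter> X))"
proof -
  have "X - (nbrs E v \<inter> X) - {v} = X - insert v (nbrs E v)" by auto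
  then have "induced E (X - (nbrs E v \<inter> X)) = induced E (X - insert v (nbrs E v))"
    using induced_remove_isolated[of v "X - (nbrs E v \<inter> X)"] by auto
  then show ?thesis using card_induced_split[of "nbrs E v \<inter> X" X] assms by simp
qed

lemma handshake_induced:
  assumes "X \<subseteq> V"
  shows "(\<Sum>v\<in>X. card (nbrs E v \<inter> X)) = 2 * card (induced E X)"
proof -
  have finX: "finite X" using assms finite_subset[OF _ finV] by auto
  have "card (nbrs E v \<inter> X) = card {e \<in> induced E X. v \<in> e}" if "v \<in> X" for v
  proof -
    have "{e \<in> induced E X. v \<in> e} = (\<lambda>w. {v, w}) ` (nbrs E v \<inter> X)"
    proof (intro equalityI subsetI)
      fix e assume e: "e \<in> {e \<in> induced E X. v \<in> e}"
      have "e \<in> E" using e by (auto simp: induced_def)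
      then obtain a b where "e = {a, b}" by (rule edge_pair)
      then show "e \<in> (\<lambda>w. {v, w}) ` (nbrs E v \<inter> X)"
        using e by (auto simp: induced_def insert_commute)
    qed (use that in \<open>auto simp: induced_def\<close>)
    then show ?thesis by (auto simp: card_image inj_on_def doubleton_eq_iff)
  qed
  then have "(\<Sum>v\<in>X. card (nbrs E v \<inter> X)) = (\<Sum>v\<in>X. card {e \<in> induced E X. v \<in> e})"
    by simp
  also have "\<dots> = (\<Sum>e\<in>induced E X. 2)"
  proof (rule sum_multicount_gen)
    show "\<forall>e\<in>induced E X. card {v \<in> X. v \<in> e} = 2"
    proof
      fix e assume e: "e \<in> induced E X"
      then have "{v \<in> X. v \<in> e} = e" by (auto simp: induced_def)
      then show "card {v \<in> X. v \<in> e} = 2" using e edge_card by (auto simp: induced_def)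
    qed
  qed (use finX in auto)
  finally show ?thesis by simp
qed

lemma handshake: "(\<Sum>v\<in>V. card (nbrs E v)) = 2 * card E"
proof -
  have "nbrs E v \<inter> V = nbrs E v" for v using nbrs_sub by blast
  then show ?thesis using handshake_induced[of V] by simp
qed

end

section \<open>Degrees and independent sets in 2-extendable graphs\<close>

locale ext2 =
  fixes V :: "'a set" and E :: "'a set set"
  assumes ext: "extendable 2 V E"
begin

sublocale sgraph V E
  using ext by unfold_locales (simp add: extendable_def connected_graph_def)

lemma card_V: "6 \<le> card V"
  using ext by (simp add: extendable_def)

lemma leaving_edge:
  assumes "X \<subseteq> V" "X \<noteq> {}" "X \<noteq> V"
  shows "\<exists>x\<in>X. \<exists>y\<in>V - X. {x, y} \<in> E"
proof (rule ccontr)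
  assume no: "\<not> ?thesis"
  obtain x y where xy: "x \<in> X" "y \<in> V - X" using assms by auto
  have "(x, y) \<in> {(x, y). {x, y} \<in> E}\<^sup>*"
    using ext xy assms(1) by (auto simp: extendable_def connected_graph_def)
  then have "y \<in> X"
  proof (induction rule: rtrancl_induct)
    case (step u v)
    then show ?case using no edgeD[of u v] by auto
  qed (use xy in auto)
  then show False using xy by auto
qed

text \<open>Listing the vertices turns the comparison with \<open>V\<close>, which has at least 6
  elements, into a bound on a length.\<close>

lemma small_leaving_edge:
  assumes "set xs \<subseteq> V" "xs \<noteq> []" "length xs < 6"
  shows "\<exists>x\<in>set xs. \<exists>y\<in>V - set xs. {x, y} \<in> E"
proof -
  have "set xs \<noteq> V" using assms(3) card_V card_length[of xs] by auto
  then show ?thesis using leaving_edge[of "set xs"] assms(1,2) by auto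
qed

lemma matching_pair:
  assumes "{a, b} \<in> E" "{c, d} \<in> E" "{a, b} \<inter> {c, d} = {}"
  obtains P where "perfect_matching V E P" "{a, b} \<in> P" "{c, d} \<in> P"
proof -
  have "matching E {{a, b}, {c, d}}"
    using assms by (auto simp: matching_def disjoint_def)
  moreover have "{a, b} \<noteq> {c, d}" using assms(3) by auto
  then have "card {{a, b}, {c, d}} = 2" by simp
  ultimately obtain P where "perfect_matching V E P" "{{a, b}, {c, d}} \<subseteq> P"
    using ext unfolding extendable_def by blast
  then show ?thesis using that by auto
qed

text \<open>In any perfect matching, pick a vertex \<open>c\<close> other than \<open>a\<close>,
  \<open>b\<close> and their partners: the matching edge at \<open>c\<close> avoids \<open>a\<close>
  and \<open>b\<close>. Consequently single edges extend to perfect matchings as well.\<close>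

lemma disjoint_edge:
  assumes "{a, b} \<in> E"
  obtains c d where "{c, d} \<in> E" "{a, b} \<inter> {c, d} = {}"
proof -
  obtain M where "matching E M" "card M = 2" using ext by (auto simp: extendable_def)
  then obtain P where P: "perfect_matching V E P" using ext by (auto simp: extendable_def)
  obtain p where p: "\<And>v. v \<in> V \<Longrightarrow> p v \<in> V" "\<And>v. v \<in> V \<Longrightarrow> p (p v) = v"
    "\<And>v. v \<in> V \<Longrightarrow> {v, p v} \<in> E"
    using perfect_matching_partner[OF P] by metis
  have "card {a, b, p a, p b} < 6" by (auto simp: card_insert_if)
  then have "\<not> V \<subseteq> {a, b, p a, p b}"
    using card_V by (meson card_mono finite.emptyI finite_insert leD order.trans)
  then obtain c where "c \<in> V" "c \<notin> {a, b, p a, p b}" by auto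
  moreover from this have "p c \<notin> {a, b}" using p(2)[of c] by auto
  ultimately show ?thesis using that[of c "p c"] p(3) by auto
qed

lemma matching_edge:
  assumes "{a, b} \<in> E"
  obtains P where "perfect_matching V E P" "{a, b} \<in> P"
  using disjoint_edge[OF assms] matching_pair[OF assms] by metis

text \<open>In a perfect matching through both edges, the partner of \<open>u\<close> is a neighbour
  that they do not cover. The degree bounds arise by covering all neighbours of
  \<open>u\<close>.\<close>

lemma free_nbr2:
  assumes "{a, b} \<in> E" "{c, d} \<in> E" "{a, b} \<inter> {c, d} = {}" "u \<in> V" "u \<notin> {a, b, c, d}"
  shows "\<not> nbrs E u \<subseteq> {a, b, c, d}"
proof -
  obtain P where P: "perfect_matching V E P" "{a, b} \<in> P" "{c, d} \<in> P"
    by (rule matching_pair[OF assms(1-3)])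
  obtain p where p: "\<And>v. v \<in> V \<Longrightarrow> p (p v) = v" "\<And>u v. {u, v} \<in> P \<Longrightarrow> p u = v"
     "\<And>v. v \<in> V \<Longrightarrow> {v, p v} \<in> E"
    using perfect_matching_partner[OF P(1)] by metis
  have "p a = b" "p b = a" "p c = d" "p d = c" using p(2) P by (auto simp: insert_commute)
  then have "p u \<notin> {a, b, c, d}" using p(1)[OF assms(4)] assms(5) by auto
  then show ?thesis using p(3)[OF assms(4)] by auto
qed

lemma free_nbr:
  assumes "{a, b} \<in> E" "u \<in> V" "u \<notin> {a, b}"
  shows "\<not> nbrs E u \<subseteq> {a, b}"
proof -
  obtain P where P: "perfect_matching V E P" "{a, b} \<in> P"
    by (rule matching_edge[OF assms(1)])
  obtain p where p: "\<And>v. v \<in> V \<Longrightarrow> p (p v) = v" "\<And>u v. {u, v} \<in> P \<Longrightarrow> p u = v"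
     "\<And>v. v \<in> V \<Longrightarrow> {v, p v} \<in> E"
    using perfect_matching_partner[OF P(1)] by metis
  have "p a = b" "p b = a" using p(2) P by (auto simp: insert_commute)
  then have "p u \<notin> {a, b}" using p(1)[OF assms(2)] assms(3) by auto
  then show ?thesis using p(3)[OF assms(2)] by auto
qed

lemma nbr_outside: "\<not> nbrs E u \<subseteq> X \<Longrightarrow> \<exists>w. {u, w} \<in> E \<and> w \<notin> X"
  by auto

lemma sym: "{u, v} \<in> E \<longleftrightarrow> {v, u} \<in> E"
  by (simp add: insert_commute)

text \<open>If \<open>a\<close> were the only neighbour of \<open>u\<close>, connectivity would give
  \<open>a\<close> another neighbour \<open>y\<close>, and no perfect matching through
  \<open>a y\<close> could cover \<open>u\<close>.\<close>

lemma two_nbrs: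
  assumes "u \<in> V"
  shows "\<not> nbrs E u \<subseteq> {a}"
proof
  assume N: "nbrs E u \<subseteq> {a}"
  obtain x y where "x \<in> set [u]" "{x, y} \<in> E"
    using small_leaving_edge[of "[u]"] assms by auto
  then have ua: "{u, a} \<in> E" using N by auto
  then have "a \<in> V" "a \<noteq> u" using edgeD by auto
  then obtain x y where "x \<in> set [u, a]" "y \<in> V - set [u, a]" "{x, y} \<in> E"
    using small_leaving_edge[of "[u, a]"] assms by auto
  then have ay: "{a, y} \<in> E" "y \<noteq> u" using N by auto
  then show False using free_nbr[OF ay(1) assms] N \<open>a \<noteq> u\<close> by auto
qed

text \<open>Two disjoint edges at \<open>a\<close> and \<open>b\<close> that avoid \<open>u\<close>
  would cover all its neighbours. So \<open>a\<close> and \<open>b\<close> have, besides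
  \<open>u\<close>, just one common neighbour \<open>c\<close>, and by connectivity \<open>c\<close>
  has an edge \<open>c y\<close> leaving these four vertices.\<close>

lemma three_nbrs:
  assumes u: "u \<in> V"
  shows "\<not> nbrs E u \<subseteq> {a, b}"
proof
  assume N: "nbrs E u \<subseteq> {a, b}"
  have ua: "{u, a} \<in> E" and ub: "{u, b} \<in> E" and ab: "a \<noteq> b"
    using two_nbrs[OF u, of a] two_nbrs[OF u, of b] N by auto
  have V: "a \<in> V" "b \<in> V" "a \<noteq> u" "b \<noteq> u" using edgeD ua ub by auto
  have nab: "{a, b} \<notin> E" using free_nbr[of a b u] N u V by auto
  have no: False if "{a, c} \<in> E" "{b, d} \<in> E" "c \<noteq> u" "d \<noteq> u" "c \<noteq> d" for c d
  proof -
    have "{a, c} \<inter> {b, d} = {}" using that ab nab sym by auto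
    then show False using free_nbr2[of a c b d u] that N u V by auto
  qed
  obtain c where c: "{a, c} \<in> E" "c \<noteq> u" using nbr_outside[OF two_nbrs[OF V(1), of u]] by auto
  obtain d where d: "{b, d} \<in> E" "d \<noteq> u" using nbr_outside[OF two_nbrs[OF V(2), of u]] by auto
  have Nb: "nbrs E b \<subseteq> {u, c}" using no[OF c(1)] c(2) by (metis in_nbrs insert_iff subsetI)
  then have "d = c" using d by auto
  then have Na: "nbrs E a \<subseteq> {u, c}" using no[OF _ d(1)] d(2) by (metis in_nbrs insert_iff subsetI)
  have cV: "c \<in> V" "c \<noteq> a" using edgeD c by auto
  have cb: "c \<noteq> b" using c nab by auto
  obtain x y where xy: "x \<in> set [u, a, b, c]" "y \<in> V - set [u, a, b, c]" "{x, y} \<in> E"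
    using small_leaving_edge[of "[u, a, b, c]"] u V cV by auto
  then have cy: "{c, y} \<in> E" using N Na Nb by auto
  obtain P where P: "perfect_matching V E P" "{c, y} \<in> P"
    by (rule matching_edge[OF cy])
  obtain p where p: "\<And>v. v \<in> V \<Longrightarrow> p (p v) = v" "\<And>u v. {u, v} \<in> P \<Longrightarrow> p u = v"
     "\<And>v. v \<in> V \<Longrightarrow> {v, p v} \<in> E"
    using perfect_matching_partner[OF P(1)] by metis
  have "p c = y" using p(2) P by auto
  \<comment> \<open>As \<open>c\<close> is matched to \<open>y\<close>, both \<open>a\<close> and
    \<open>b\<close> have only \<open>u\<close> left as a partner.\<close>
  have "p a = u" using p(1,3)[OF V(1)] Na \<open>p c = y\<close> xy by auto
  moreover have "p b = u" using p(1,3)[OF V(2)] Nb \<open>p c = y\<close> xy by auto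
  ultimately show False using p(1) V ab by metis
qed

lemma min_degree: "u \<in> V \<Longrightarrow> 3 \<le> card (nbrs E u)"
proof (rule ccontr)
  assume u: "u \<in> V" and "\<not> 3 \<le> card (nbrs E u)"
  then have "card (nbrs E u) \<le> 2" by auto
  then consider "card (nbrs E u) = 0" | "card (nbrs E u) = 1" | "card (nbrs E u) = 2"
    by linarith
  then show False
    using three_nbrs[OF u] by cases (auto simp: card_1_singleton_iff card_2_iff; blast)+
qed

text \<open>Let \<open>a b\<close> be an edge among the neighbours and \<open>c\<close> the third
  one. An edge from \<open>c\<close> to a vertex outside \<open>{u, a, b}\<close> would, with
  \<open>a b\<close>, cover all neighbours of \<open>u\<close>; so \<open>c\<close> has no such
  edge. Some edge then leaves the four vertices at \<open>a\<close> or \<open>b\<close>, and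
  together with the edge from \<open>u\<close> to the other one it covers all neighbours of
  \<open>c\<close>.\<close>

lemma cubic_nbrs_indep:
  assumes u: "u \<in> V" and d: "card (nbrs E u) = 3"
  shows "indep E (nbrs E u)"
proof (rule ccontr)
  assume "\<not> indep E (nbrs E u)"
  then obtain a b where ab: "{u, a} \<in> E" "{u, b} \<in> E" "{a, b} \<in> E" by (auto simp: indep_def)
  have V: "a \<in> V" "b \<in> V" "a \<noteq> u" "b \<noteq> u" "a \<noteq> b" using edgeD ab by auto
  have "card (nbrs E u - {a, b}) = 1" using d V ab by (subst card_Diff_subset) auto
  then obtain c where c: "nbrs E u - {a, b} = {c}" by (auto simp: card_1_singleton_iff)
  then have "c \<in> nbrs E u - {a, b}" by simp
  then have uc: "{u, c} \<in> E" and cab: "c \<noteq> a" "c \<noteq> b" by auto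
  have "nbrs E u \<subseteq> insert a (insert b (nbrs E u - {a, b}))" by blast
  then have Nu: "nbrs E u \<subseteq> {a, b, c}" by (simp only: c)
  have cV: "c \<in> V" "c \<noteq> u" using edgeD uc by auto
  have "d \<in> {u, a, b}" if "{c, d} \<in> E" for d
  proof (rule ccontr)
    assume "d \<notin> {u, a, b}"
    then show False using free_nbr2[OF ab(3) that, of u] Nu u V cV cab by auto
  qed
  then have Nc: "nbrs E c \<subseteq> {u, a, b}" unfolding nbrs_def by blast
  have no: False if xy: "{x, z} \<in> E" "z \<notin> {u, a, b, c}" "{u, y} \<in> E" "{x, y} = {a, b}" for x y z
  proof -
    have "{x, z} \<inter> {u, y} = {}" "c \<notin> {x, z, u, y}" using xy V cV cab by (auto simp: doubleton_eq_iff)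
    then show False using free_nbr2[OF xy(1,3) _ cV(1)] Nc xy by (auto simp: doubleton_eq_iff)
  qed
  obtain x y where xy: "x \<in> set [u, a, b, c]" "y \<in> V - set [u, a, b, c]" "{x, y} \<in> E"
    using small_leaving_edge[of "[u, a, b, c]"] u V cV by auto
  then have "{a, y} \<in> E \<or> {b, y} \<in> E" using Nu Nc by auto
  then show False using no[of a y b] no[of b y a] ab xy by auto
qed

text \<open>Moving \<open>x\<close> to the side of \<open>I\<close> keeps that side independent and
  removes all remaining edges from the other side.\<close>

lemma bipartite_star:
  assumes "indep E I" "I \<subseteq> V" "x \<in> V - I" "\<And>i. i \<in> I \<Longrightarrow> {x, i} \<notin> E"
    "\<And>u v. u \<in> V - I \<Longrightarrow> v \<in> V - I \<Longrightarrow> {u, v} \<in> E \<Longrightarrow> u = x \<or> v = x"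
  shows "bipartite V E"
proof -
  have "\<exists>a\<in>insert x I. \<exists>b\<in>V - I - {x}. e = {a, b}" if e: "e \<in> E" for e
  proof -
    obtain u v where uv: "e = {u, v}" by (rule edge_pair[OF e])
    have *: "\<exists>a\<in>insert x I. \<exists>b\<in>V - I - {x}. {u, v} = {a, b}"
      if "{u, v} \<in> E" "u \<in> insert x I" for u v
    proof -
      have "v \<notin> insert x I"
        using that assms(1,4) sym edgeD by (auto simp: indep_def)
      then have "v \<in> V - I - {x}" using that edgeD by auto
      then show ?thesis using that by blast
    qed
    show ?thesis
    proof (cases "u \<in> insert x I \<or> v \<in> insert x I")
      case True
      then show ?thesis using *[of u v] *[of v u] uv e by (auto simp: insert_commute)
    next
      case False
      then show ?thesis using assms(5)[of u v] uv e edgeD by auto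
    qed
  qed
  then show ?thesis unfolding bipartite_def using assms(2,3)
    by (intro exI[of _ "insert x I"] exI[of _ "V - I - {x}"]) auto
qed

text \<open>The end of the argument: the ends \<open>a\<close>, \<open>b\<close> of an edge in
  \<open>T\<close> have one and the same single neighbour \<open>i\<close> in \<open>J\<close>.
  Their further neighbours in \<open>T\<close> must coincide too, in a vertex \<open>z\<close>. So
  \<open>a\<close> is cubic with neighbours \<open>b\<close>, \<open>i\<close>, \<open>z\<close> and
  lies in the triangle \<open>a b z\<close>, which \<open>cubic_nbrs_indep\<close> forbids.\<close>

lemma indep_card:
  assumes ev: "even (card V)" and nb: "\<not> bipartite V E" and I: "indep E I" "I \<subseteq> V"
  shows "2 * card I + 4 \<le> card V"
proof (rule ccontr)
  assume "\<not> ?thesis"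
  then have "card V div 2 - 1 \<le> card I" using ev by presburger
  then obtain J where J: "J \<subseteq> I" "card J = card V div 2 - 1"
    using obtain_subset_with_card_n by metis
  have JV: "J \<subseteq> V" and Ji: "indep E J" using J I indep_subset by auto
  have fJ: "finite J" using JV by (rule finite_subset) simp
  define T where "T = V - J"
  have fT: "finite T" by (simp add: T_def)
  have cT: "card T = card J + 2"
    using card_Diff_subset[OF fJ JV] J(2) ev card_V by (auto simp: T_def elim!: evenE)
  \<comment> \<open>\<open>T\<close> is too large to be matched into \<open>J\<close>, so some
    matching edge lies inside \<open>T\<close>; it avoids the edge at \<open>x\<close>, which ends
    in \<open>J\<close>.\<close>
  have inner: "\<exists>t\<in>T. {t, p t} \<in> E \<and> p t \<in> T \<and> t \<notin> {x, p x} \<and> p t \<notin> {x, p x}"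
    if p: "\<And>v. v \<in> V \<Longrightarrow> p v \<in> V" "\<And>v. v \<in> V \<Longrightarrow> p (p v) = v" "inj_on p V"
     "\<And>v. v \<in> V \<Longrightarrow> {v, p v} \<in> E" and x: "x \<in> T" "p x \<in> J" for p x
  proof -
    have "\<not> p ` T \<subseteq> J"
    proof
      assume "p ` T \<subseteq> J"
      then have "card T \<le> card J"
        using card_inj_on_le[of p T J] inj_on_subset[OF p(3)] fJ by (auto simp: T_def)
      then show False using cT by simp
    qed
    then obtain t where t: "t \<in> T" "p t \<notin> J" by auto
    moreover have "p t \<in> T" using t p(1) by (auto simp: T_def)
    moreover have "t \<noteq> x" "t \<noteq> p x" "p t \<noteq> p x" using t x by (auto simp: T_def)
    moreover have "p t \<noteq> x" using t x p(2)[of t] by (auto simp: T_def)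
    ultimately show ?thesis using p(4)[of t] by (auto simp: T_def)
  qed
  have no2: False if h: "a \<in> T" "b \<in> T" "c \<in> T" "d \<in> T" "{a, b} \<in> E" "{c, d} \<in> E"
    "{a, b} \<inter> {c, d} = {}" for a b c d
  proof -
    obtain P where P: "perfect_matching V E P" "{a, b} \<in> P" "{c, d} \<in> P"
      by (rule matching_pair[OF h(5-7)])
    obtain p where p: "\<And>v. v \<in> V \<Longrightarrow> {v, p v} \<in> P" "\<And>v. v \<in> V \<Longrightarrow> p v \<in> V"
      "\<And>v. v \<in> V \<Longrightarrow> p (p v) = v" "\<And>u v. {u, v} \<in> P \<Longrightarrow> p u = v" "inj_on p V"
      "\<And>v. v \<in> V \<Longrightarrow> {v, p v} \<in> E"
      by (rule perfect_matching_partner[OF P(1)]) blast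
    have pab: "p a = b" "p b = a" "p c = d" "p d = c" using p(4) P by (auto simp: insert_commute)
    \<comment> \<open>The partners of \<open>J\<close> would have to fit into the remaining
      \<open>card T - 4 = card J - 2\<close> vertices of \<open>T\<close>.\<close>
    have "p ` J \<subseteq> T - {a, b, c, d}"
    proof
      fix y assume "y \<in> p ` J"
      then obtain j where j: "j \<in> J" "y = p j" by auto
      have "p j \<notin> J" using p(6)[of j] j Ji JV by (auto simp: indep_def)
      have jV: "p (p j) = j" "p j \<in> V" using p(2,3) j JV by auto
      have "j \<notin> {a, b, c, d}" using j(1) h(1-4) by (auto simp: T_def)
      then have "p j \<notin> {a, b, c, d}" using pab jV(1) by auto
      then show "y \<in> T - {a, b, c, d}" using \<open>p j \<notin> J\<close> jV j by (auto simp: T_def)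
    qed
    then have "card J \<le> card (T - {a, b, c, d})"
      using card_inj_on_le[of p J] inj_on_subset[OF p(5) JV] fT by auto
    also have "\<dots> = card T - card {a, b, c, d}"
      using h by (intro card_Diff_subset) auto
    also have "card {a, b, c, d} = 4"
      using h edgeD[OF h(5)] edgeD[OF h(6)] by auto
    finally show False using cT J(2) card_V by auto
  qed
  \<comment> \<open>A perfect matching through \<open>x i\<close> and \<open>y j\<close> still has
    an edge inside \<open>T\<close>, and that edge is disjoint from \<open>x y\<close>, contrary to
    \<open>no2\<close>.\<close>
  have no_cross: False if h: "x \<in> T" "y \<in> T" "i \<in> J" "j \<in> J" "i \<noteq> j" "{x, y} \<in> E" "{x, i} \<in> E" "{y, j} \<in> E"
    for x y i j
  proof -
    have xy: "x \<noteq> y" "x \<notin> J" "y \<notin> J" using edgeD[OF h(6)] h(1,2) by (auto simp: T_def)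
    have "{x, i} \<inter> {y, j} = {}" using h xy by auto
    then obtain P where P: "perfect_matching V E P" "{x, i} \<in> P" "{y, j} \<in> P"
      by (rule matching_pair[OF h(7,8)])
    obtain p where p: "\<And>v. v \<in> V \<Longrightarrow> {v, p v} \<in> P" "\<And>v. v \<in> V \<Longrightarrow> p v \<in> V"
      "\<And>v. v \<in> V \<Longrightarrow> p (p v) = v" "\<And>u v. {u, v} \<in> P \<Longrightarrow> p u = v" "inj_on p V"
      "\<And>v. v \<in> V \<Longrightarrow> {v, p v} \<in> E"
      by (rule perfect_matching_partner[OF P(1)]) blast
    have pab: "p x = i" "p i = x" "p y = j" "p j = y" using p(4) P by (auto simp: insert_commute)
    have px: "p x \<in> J" using pab h by simp
    obtain t where t: "t \<in> T" "{t, p t} \<in> E" "p t \<in> T" "t \<notin> {x, p x}" "p t \<notin> {x, p x}"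
      using inner[OF p(2,3,5,6) h(1) px] by auto
    have "t \<noteq> y" using pab t(3) h by (auto simp: T_def)
    moreover have "p t \<noteq> y" using pab p(3)[of t] t h by (auto simp: T_def)
    ultimately show False using no2[of x y t "p t"] t h by auto
  qed
  \<comment> \<open>An edge \<open>u v\<close> of \<open>T\<close> missing \<open>x\<close> would be
    disjoint from an edge \<open>x w\<close>, as \<open>x\<close> has a third neighbour
    \<open>w\<close>. So all edges of \<open>T\<close> meet in \<open>x\<close>.\<close>
  have no_isolated: "bipartite V E" if x: "x \<in> T" "nbrs E x \<subseteq> T" for x
  proof (rule bipartite_star[OF Ji JV])
    show "x \<in> V - J" using x by (simp add: T_def)
    show "{x, i} \<notin> E" if "i \<in> J" for i using that x by (auto simp: T_def)
    fix u v assume uv: "u \<in> V - J" "v \<in> V - J" "{u, v} \<in> E"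
    show "u = x \<or> v = x"
    proof (rule ccontr)
      assume ne: "\<not> ?thesis"
      have "\<not> nbrs E x \<subseteq> {u, v}" using three_nbrs x by (auto simp: T_def)
      then obtain w where "{x, w} \<in> E" "w \<notin> {u, v}" using nbr_outside by metis
      then show False using no2[of x w u v] uv ne x by (auto simp: T_def)
    qed
  qed
  have toJ: "\<exists>i. {x, i} \<in> E \<and> i \<in> J" if "x \<in> T" for x
  proof -
    have "\<not> nbrs E x \<subseteq> T" using no_isolated that nb by blast
    then obtain i where "{x, i} \<in> E" "i \<notin> T" using nbr_outside by blast
    then show ?thesis using edgeD[of x i] by (auto simp: T_def)
  qed
  obtain a b where ab: "a \<in> T" "b \<in> T" "{a, b} \<in> E"
  proof -
    have "\<exists>a\<in>T. \<exists>b\<in>T. {a, b} \<in> E"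
    proof (rule ccontr)
      assume no: "\<not> ?thesis"
      obtain M where "matching E M" "card M = 2" using ext by (auto simp: extendable_def)
      then obtain P where P: "perfect_matching V E P" using ext by (auto simp: extendable_def)
      obtain p where p: "\<And>v. v \<in> V \<Longrightarrow> p v \<in> V" "inj_on p V" "\<And>v. v \<in> V \<Longrightarrow> {v, p v} \<in> E"
        using perfect_matching_partner[OF P] by metis
      have "p ` T \<subseteq> J" using no p(1,3) by (auto simp: T_def)
      then have "card T \<le> card J"
        using card_inj_on_le[of p T J] inj_on_subset[OF p(2)] fJ by (auto simp: T_def)
      then show False using cT by simp
    qed
    then show ?thesis using that by blast
  qed
  have abV: "a \<in> V" "b \<in> V" "a \<noteq> b" using edgeD ab by auto
  obtain i where i: "{a, i} \<in> E" "i \<in> J"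
    using toJ[OF ab(1)] by blast
  obtain j where j: "{b, j} \<in> E" "j \<in> J"
    using toJ[OF ab(2)] by blast
  \<comment> \<open>By \<open>no_cross\<close>, every neighbour of \<open>a\<close> in
    \<open>J\<close> equals every neighbour of \<open>b\<close> in \<open>J\<close>.\<close>
  have Ja: "nbrs E a \<inter> J \<subseteq> {j}" and Jb: "nbrs E b \<inter> J \<subseteq> {i}"
    using no_cross[OF ab(1,2) _ j(2) _ ab(3) _ j(1)] no_cross[OF ab(1,2) i(2) _ _ ab(3) i(1)]
    by (auto, metis+)
  then have "i = j" using i by auto
  obtain z where z: "{a, z} \<in> E" "z \<notin> {b, i}" using nbr_outside[OF three_nbrs[OF abV(1), of b i]] by auto
  obtain w where w: "{b, w} \<in> E" "w \<notin> {a, i}" using nbr_outside[OF three_nbrs[OF abV(2), of a i]] by auto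
  have zT: "z \<in> T" using z Ja \<open>i = j\<close> edgeD by (auto simp: T_def)
  have wT: "w \<in> T" using w Jb edgeD by (auto simp: T_def)
  have eq: "z' = w'" if "{a, z'} \<in> E" "z' \<in> T" "z' \<noteq> b" "{b, w'} \<in> E" "w' \<in> T" "w' \<noteq> a" for z' w'
  proof (rule ccontr)
    assume "z' \<noteq> w'"
    then have "{a, z'} \<inter> {b, w'} = {}" using that abV by auto
    then show False using no2[of a z' b w'] that ab by auto
  qed
  have "z = w" using eq z zT w wT by auto
  have "nbrs E a \<subseteq> {b, i, z}"
  proof
    fix y assume y: "y \<in> nbrs E a"
    then have "y \<in> J \<or> y \<in> T" using edgeD by (auto simp: T_def)
    then show "y \<in> {b, i, z}" using y Ja \<open>i = j\<close> eq[of y w] w wT \<open>z = w\<close> by auto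
  qed
  then have "card (nbrs E a) \<le> card {b, i, z}" by (intro card_mono) auto
  then have "card (nbrs E a) = 3" using min_degree[OF abV(1)] by (auto simp: card_insert_if split: if_splits)
  then have "indep E (nbrs E a)" using cubic_nbrs_indep abV by auto
  moreover have "z \<in> nbrs E a" "b \<in> nbrs E a" using z ab by auto
  ultimately show False using w \<open>z = w\<close> by (auto simp: indep_def)
qed

end

section \<open>Lower bounds\<close>

definition tri_free :: "'a set set \<Rightarrow> 'a set \<Rightarrow> bool" where
  "tri_free E X \<longleftrightarrow> (\<forall>v\<in>X. indep E (nbrs E v \<inter> X))"

definition alpha_le :: "'a set set \<Rightarrow> 'a set \<Rightarrow> nat \<Rightarrow> bool" where
  "alpha_le E X k \<longleftrightarrow> (\<forall>I. I \<subseteq> X \<longrightarrow> indep E I \<longrightarrow> card I \<le> k)"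

lemma alpha_leD: "alpha_le E X k \<Longrightarrow> I \<subseteq> X \<Longrightarrow> indep E I \<Longrightarrow> card I \<le> k"
  by (simp add: alpha_le_def)

lemma tri_free_subset: "tri_free E X \<Longrightarrow> Y \<subseteq> X \<Longrightarrow> tri_free E Y"
  unfolding tri_free_def indep_def by blast

context sgraph
begin

lemma indep_insert:
  assumes "indep E I" "nbrs E v \<inter> I = {}"
  shows "indep E (insert v I)"
  using assms unfolding indep_def nbrs_def by (auto simp: insert_commute)

lemma indep_empty [simp]: "indep E {}"
  by (simp add: indep_def)

text \<open>The vertex \<open>v\<close> can be added to any independent set of its
  non-neighbours.\<close>

lemma alpha_le_remove_nbrs:
  assumes "alpha_le E X (Suc k)" "v \<in> X" "X \<subseteq> V"
  shows "alpha_le E (X - insert v (nbrs E v)) k"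
  unfolding alpha_le_def
proof (intro allI impI)
  fix I assume I: "I \<subseteq> X - insert v (nbrs E v)" "indep E I"
  have "finite I" using I(1) assms(3) by (intro finite_subset[OF _ finV]) auto
  moreover have "indep E (insert v I)" using I by (intro indep_insert) auto
  then have "card (insert v I) \<le> Suc k"
    using I(1) assms(2) by (intro alpha_leD[OF assms(1)]) auto
  moreover have "v \<notin> I" using I(1) by auto
  ultimately show "card I \<le> k" by simp
qed

lemma degree_sum_ge:
  assumes "\<And>v. v \<in> V \<Longrightarrow> d \<le> card (nbrs E v)"
  shows "d * card V \<le> 2 * card E"
proof -
  have "(\<Sum>v\<in>V. d) \<le> (\<Sum>v\<in>V. card (nbrs E v))" by (rule sum_mono) (rule assms)
  then show ?thesis by (simp add: handshake mult.commute)
qed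

lemma cross_count:
  assumes "finite A" "finite B"
  shows "(\<Sum>a\<in>A. card (nbrs E a \<inter> B)) = (\<Sum>b\<in>B. card (nbrs E b \<inter> A))"
proof -
  have "nbrs E a \<inter> B = {b \<in> B. {a, b} \<in> E}" for a by auto
  moreover have "nbrs E b \<inter> A = {a \<in> A. {a, b} \<in> E}" for b by (auto simp: insert_commute)
  ultimately show ?thesis using assms by (simp add: sum_multicount_gen)
qed

lemma card_partition_nbrs:
  assumes "v \<in> X" "finite X"
  shows "card X = Suc (card (nbrs E v \<inter> X) + card (X - insert v (nbrs E v)))"
proof -
  have "X = insert v ((nbrs E v \<inter> X) \<union> (X - insert v (nbrs E v)))" using assms(1) by auto
  then have "card X = card (insert v ((nbrs E v \<inter> X) \<union> (X - insert v (nbrs E v))))" by simp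
  also have "\<dots> = Suc (card ((nbrs E v \<inter> X) \<union> (X - insert v (nbrs E v))))"
    using assms(2) by (intro card_insert_disjoint) auto
  also have "card ((nbrs E v \<inter> X) \<union> (X - insert v (nbrs E v)))
      = card (nbrs E v \<inter> X) + card (X - insert v (nbrs E v))"
    using assms(2) by (intro card_Un_disjoint) auto
  finally show ?thesis .
qed

text \<open>The non-neighbours of \<open>v\<close> form a clique, so without triangles there are at
  most two of them.\<close>

lemma degrees_no_K3_alpha2:
  assumes "X \<subseteq> V" "tri_free E X" "alpha_le E X 2" "v \<in> X"
  shows "card (nbrs E v \<inter> X) \<le> 2" "card X \<le> 3 + card (nbrs E v \<inter> X)"
proof -
  show "card (nbrs E v \<inter> X) \<le> 2"
    using assms(2,4) by (intro alpha_leD[OF assms(3)]) (auto simp: tri_free_def)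
  define Q where "Q = X - insert v (nbrs E v)"
  have finX: "finite X" using assms(1) finite_subset finV by blast
  have QX: "Q \<subseteq> X" by (auto simp: Q_def)
  have aQ: "alpha_le E Q 1"
    using alpha_le_remove_nbrs[of X 1 v] assms by (simp add: Q_def numeral_2_eq_2)
  have clq: "{a, b} \<in> E" if "a \<in> Q" "b \<in> Q" "a \<noteq> b" for a b
  proof (rule ccontr)
    assume "{a, b} \<notin> E"
    then have "indep E {a, b}" by (auto simp: indep_def insert_commute)
    then have "card {a, b} \<le> 1" using that by (intro alpha_leD[OF aQ]) auto
    then show False using that by simp
  qed
  have "card Q \<le> 2"
  proof (rule ccontr)
    assume "\<not> card Q \<le> 2"
    then obtain R where "R \<subseteq> Q" "card R = 3"
      using obtain_subset_with_card_n[of 3 Q] by auto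
    then obtain a b c where abc: "a \<in> Q" "b \<in> Q" "c \<in> Q" "a \<noteq> b" "a \<noteq> c" "b \<noteq> c"
      by (auto simp: card_3_iff)
    have e: "{a, b} \<in> E" "{a, c} \<in> E" "{b, c} \<in> E" using clq abc by auto
    have "indep E (nbrs E a \<inter> X)" using assms(2) abc QX by (auto simp: tri_free_def)
    moreover have "b \<in> nbrs E a \<inter> X" "c \<in> nbrs E a \<inter> X" using e abc QX by auto
    ultimately show False using e(3) unfolding indep_def by blast
  qed
  then show "card X \<le> 3 + card (nbrs E v \<inter> X)"
    using card_partition_nbrs[OF assms(4) finX] by (simp add: Q_def)
qed

text \<open>The first part is the Ramsey number R(3,3) = 6. The second is needed for five vertices,
  where it gives the five edges of the pentagon.\<close>

lemma edges_no_K3_alpha2: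
  assumes "X \<subseteq> V" "tri_free E X" "alpha_le E X 2"
  shows "card X \<le> 5" "card X * (card X - 3) \<le> 2 * card (induced E X)"
proof -
  note d = degrees_no_K3_alpha2[OF assms]
  show "card X \<le> 5"
  proof (cases "X = {}")
    case False
    then obtain v where "v \<in> X" by auto
    then show ?thesis using d[of v] by linarith
  qed simp
  have "(\<Sum>v\<in>X. card X - 3) \<le> (\<Sum>v\<in>X. card (nbrs E v \<inter> X))"
    by (rule sum_mono) (use d in \<open>simp add: le_diff_conv add.commute\<close>)
  then show "card X * (card X - 3) \<le> 2 * card (induced E X)"
    by (simp add: handshake_induced[OF assms(1)])
qed

text \<open>Eight vertices is the largest possible case, since R(3,4) = 9. All degrees are 2 or 3;
  with at most nine edges, vertices of both degrees occur but cannot be adjacent, and too few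
  vertices of degree 3 remain to be each other's neighbours.\<close>

lemma edges_no_K3_alpha3:
  assumes X: "X \<subseteq> V" "card X = 8" and tf: "tri_free E X" and al: "alpha_le E X 3"
  shows "10 \<le> card (induced E X)"
proof (rule ccontr)
  assume "\<not> 10 \<le> card (induced E X)"
  then have small: "card (induced E X) \<le> 9" by simp
  have finX: "finite X" using X(1) finite_subset finV by blast
  define d where "d v = card (nbrs E v \<inter> X)" for v
  have ds: "2 \<le> d v \<and> d v \<le> 3" if v: "v \<in> X" for v
  proof -
    let ?Q = "X - insert v (nbrs E v)"
    have al2: "alpha_le E ?Q 2"
      using alpha_le_remove_nbrs[of X 2 v] al v X by (simp add: numeral_3_eq_3 numeral_2_eq_2)
    have "?Q \<subseteq> X" by auto
    then have "card ?Q \<le> 5"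
      using X(1) edges_no_K3_alpha2(1)[OF _ tri_free_subset[OF tf] al2] by auto
    moreover have "d v \<le> 3"
      unfolding d_def using tf v by (intro alpha_leD[OF al]) (auto simp: tri_free_def)
    ultimately show ?thesis using card_partition_nbrs[OF v finX] X(2) by (simp add: d_def)
  qed
  \<comment> \<open>The five non-neighbours of \<open>v\<close> span at least five edges and its two
    neighbours account for at least four more. A total of at most nine forces equality
    throughout.\<close>
  have nb2: "card (induced E X) = 9 \<and> (\<forall>w\<in>nbrs E v \<inter> X. d w = 2)"
    if v: "v \<in> X" "d v = 2" for v
  proof -
    let ?Q = "X - insert v (nbrs E v)"
    have al2: "alpha_le E ?Q 2"
      using alpha_le_remove_nbrs[of X 2 v] al v X by (simp add: numeral_3_eq_3 numeral_2_eq_2)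
    have QV: "?Q \<subseteq> V" "?Q \<subseteq> X" using X(1) by auto
    have "card ?Q = 5" using card_partition_nbrs[OF v(1) finX] X(2) v(2) by (simp add: d_def)
    then have q: "5 \<le> card (induced E ?Q)"
      using edges_no_K3_alpha2(2)[OF QV(1) tri_free_subset[OF tf QV(2)] al2] by simp
    have "indep E (nbrs E v \<inter> X)" using tf v(1) by (simp add: tri_free_def)
    then have e: "card (induced E X) = card (induced E ?Q) + (\<Sum>w\<in>nbrs E v \<inter> X. d w)"
      using card_induced_split_nbrs[OF X(1)] by (simp add: d_def)
    obtain a b where ab: "nbrs E v \<inter> X = {a, b}" "a \<noteq> b" using v(2) by (auto simp: d_def card_2_iff)
    have "a \<in> X" "b \<in> X" using ab by auto
    then have "2 \<le> d a" "2 \<le> d b" using ds by auto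
    moreover have "card (induced E X) = card (induced E ?Q) + (d a + d b)" using e ab by simp
    ultimately show ?thesis using q small ab by auto
  qed
  have hs: "(\<Sum>v\<in>X. d v) = 2 * card (induced E X)"
    unfolding d_def by (rule handshake_induced[OF X(1)])
  define D where "D = {v \<in> X. d v = 3}"
  have "d v = 2 + (if v \<in> D then 1 else 0)" if "v \<in> X" for v
    using ds[OF that] that by (auto simp: D_def)
  then have "(\<Sum>v\<in>X. d v) = (\<Sum>v\<in>X. 2 + (if v \<in> D then 1 else 0))"
    by (rule sum.cong[OF refl])
  also have "\<dots> = 16 + (\<Sum>v\<in>X. if v \<in> D then 1 else 0)"
    by (subst sum.distrib) (simp add: X(2))
  also have "(\<Sum>v\<in>X. if v \<in> D then 1 else (0::nat)) = card D"
    using sum.inter_restrict[OF finX, of "\<lambda>_. 1::nat" D] by (simp add: D_def Collect_conj_eq)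
  finally have cD: "16 + card D = 2 * card (induced E X)" using hs by simp
  have finD: "finite D" using finX by (simp add: D_def)
  \<comment> \<open>Eight vertices of degree 3 would give twelve edges.\<close>
  have "card D \<noteq> 8" using cD small by auto
  then have "D \<noteq> X" using X(2) by auto
  then obtain v where "v \<in> X" "d v \<noteq> 3" by (auto simp: D_def)
  then have "v \<in> X" "d v = 2" using ds[of v] by auto
  then have "card (induced E X) = 9" using nb2 by blast
  then have "card D = 2" using cD by simp
  then obtain w where w: "w \<in> D" by fastforce
  \<comment> \<open>The three neighbours of \<open>w\<close> would all lie in \<open>D\<close>,
    which has only one other element.\<close>
  have "nbrs E w \<inter> X \<subseteq> D - {w}"
  proof
    fix u assume u: "u \<in> nbrs E w \<inter> X"
    have "w \<in> nbrs E u \<inter> X" using u w by (auto simp: D_def insert_commute)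
    then have "d u \<noteq> 2" using nb2[of u] u w by (auto simp: D_def)
    then show "u \<in> D - {w}" using ds[of u] u by (auto simp: D_def)
  qed
  then have "card (nbrs E w \<inter> X) \<le> card (D - {w})" using finD by (intro card_mono) auto
  then show False using w \<open>card D = 2\<close> finD by (simp add: D_def d_def)
qed

end

section \<open>Edge bounds for non-bipartite 2-extendable graphs\<close>

locale nonbip_ext2 = ext2 +
  assumes even_V: "even (card V)" and nonbip: "\<not> bipartite V E"
begin

text \<open>From \<open>2 * card I + 4 \<le> 2 * k + 5\<close> parity still gives
  \<open>card I \<le> k\<close>, hence 5 instead of 4.\<close>

lemma alpha: "2 * k + 5 \<ge> card V \<Longrightarrow> alpha_le E V k"
  unfolding alpha_le_def using indep_card[OF even_V nonbip] by fastforce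

lemma indep_pairI: "{a, b} \<notin> E \<Longrightarrow> indep E {a, b}"
  by (auto simp: indep_def insert_commute)

lemma degree_V_split: "v \<in> V \<Longrightarrow> card V = Suc (card (nbrs E v) + card (V - insert v (nbrs E v)))"
  using card_partition_nbrs[of v V] nbrs_sub[of v] by (simp add: Int_absorb2)

lemma size_ge: "3 * card V \<le> 2 * card E"
  by (rule degree_sum_ge) (rule min_degree)

lemma size_ge_6:
  assumes "card V = 6"
  shows "15 \<le> card E"
proof -
  have al: "alpha_le E V 1" using alpha assms by simp
  have "5 \<le> card (nbrs E v)" if v: "v \<in> V" for v
  proof -
    have "V - insert v (nbrs E v) = {}"
    proof (rule ccontr)
      assume "V - insert v (nbrs E v) \<noteq> {}"
      then obtain w where w: "w \<in> V" "w \<noteq> v" "{v, w} \<notin> E"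
        unfolding nbrs_def by blast
      then have "card {v, w} \<le> 1" using v by (intro alpha_leD[OF al] indep_pairI) auto
      then show False using w by simp
    qed
    then have "card (V - insert v (nbrs E v)) = 0" by (simp only: card.empty)
    then show ?thesis using degree_V_split[OF v] assms by linarith
  qed
  then show ?thesis using degree_sum_ge[of 5] assms by simp
qed

text \<open>The neighbours of a cubic vertex would be three independent vertices, but at most two
  are allowed; so all degrees are at least 4.\<close>

lemma size_ge_8:
  assumes "card V = 8"
  shows "16 \<le> card E"
proof -
  have al: "alpha_le E V 2" using alpha assms by simp
  have "4 \<le> card (nbrs E v)" if v: "v \<in> V" for v
  proof (rule ccontr)
    assume "\<not> 4 \<le> card (nbrs E v)"
    then have c: "card (nbrs E v) = 3" using min_degree[OF v] by simp
    then have "card (nbrs E v) \<le> 2"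
      using cubic_nbrs_indep[OF v] nbrs_sub by (intro alpha_leD[OF al])
    then show False using c by simp
  qed
  then show ?thesis using degree_sum_ge[of 4] assms by simp
qed

lemma exists_cubic:
  assumes "card E < 2 * card V"
  obtains v where "v \<in> V" "card (nbrs E v) = 3"
proof -
  have "\<not> (\<forall>v\<in>V. 4 \<le> card (nbrs E v))" using degree_sum_ge[of 4] assms by auto
  then obtain v where "v \<in> V" "\<not> 4 \<le> card (nbrs E v)" by auto
  then show ?thesis using that[of v] min_degree[of v] by simp
qed

text \<open>With at most 19 edges there is no triangle, so \<open>edges_no_K3_alpha3\<close> applies
  to the eight vertices left by a cubic vertex and its neighbours. Then 10 + 9 = 19 is tight and
  forces these neighbours to be cubic. Connectivity spreads this to the whole graph, which would
  have only 18 edges.\<close>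

lemma size_ge_12:
  assumes c12: "card V = 12"
  shows "20 \<le> card E"
proof (rule ccontr)
  assume "\<not> 20 \<le> card E"
  then have small: "card E \<le> 19" by simp
  have al: "alpha_le E V 4" using alpha assms by simp
  \<comment> \<open>Vertices of a triangle have degree at least 4, so a triangle raises the degree
    sum to 3 * 4 + 9 * 3 = 39, more than 2 * 19.\<close>
  have tf: "tri_free E V"
    unfolding tri_free_def
  proof (rule ccontr)
    assume "\<not> (\<forall>v\<in>V. indep E (nbrs E v \<inter> V))"
    then obtain x y z where t: "{x, y} \<in> E" "{x, z} \<in> E" "{y, z} \<in> E"
      by (auto simp: indep_def)
    have V: "x \<in> V" "y \<in> V" "z \<in> V" "x \<noteq> y" "x \<noteq> z" "y \<noteq> z" using edgeD t by auto
    have ge4: "4 \<le> card (nbrs E u)" if u: "u \<in> V" "v \<in> nbrs E u" "w \<in> nbrs E u" "{v, w} \<in> E" for u v w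
    proof (rule ccontr)
      assume "\<not> 4 \<le> card (nbrs E u)"
      then have "card (nbrs E u) = 3" using min_degree[OF u(1)] by simp
      then have "indep E (nbrs E u)" using cubic_nbrs_indep[OF u(1)] by simp
      then show False using u unfolding indep_def by blast
    qed
    have t4: "4 \<le> card (nbrs E u)" if "u \<in> {x, y, z}" for u
      using that ge4[of x y z] ge4[of y x z] ge4[of z x y] t V by (auto simp: insert_commute)
    have "(\<Sum>v\<in>{x, y, z}. 4) \<le> (\<Sum>v\<in>{x, y, z}. card (nbrs E v))"
      by (rule sum_mono) (rule t4)
    moreover have "(\<Sum>v\<in>V - {x, y, z}. 3) \<le> (\<Sum>v\<in>V - {x, y, z}. card (nbrs E v))"
      by (rule sum_mono) (use min_degree in auto)
    moreover have "card (V - {x, y, z}) = 9" using V c12 by (subst card_Diff_subset) auto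
    moreover have "(\<Sum>v\<in>V. card (nbrs E v)) =
        (\<Sum>v\<in>V - {x, y, z}. card (nbrs E v)) + (\<Sum>v\<in>{x, y, z}. card (nbrs E v))"
      using V by (intro sum.subset_diff) auto
    moreover have "card {x, y, z} = 3" using V by simp
    ultimately have "39 \<le> 2 * card E" by (simp add: handshake)
    then show False using small by simp
  qed
  have cubic: "card E = 19 \<and> (\<forall>w\<in>nbrs E v. card (nbrs E w) = 3)"
    if v: "v \<in> V" "card (nbrs E v) = 3" for v
  proof -
    let ?Q = "V - insert v (nbrs E v)"
    have "alpha_le E ?Q 3"
      using alpha_le_remove_nbrs[of V 3 v] al v by (simp add: eval_nat_numeral)
    moreover have "card ?Q = 8" using degree_V_split[OF v(1)] v(2) c12 by simp
    moreover have "tri_free E ?Q" by (rule tri_free_subset[OF tf]) auto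
    ultimately have q: "10 \<le> card (induced E ?Q)" by (intro edges_no_K3_alpha3) auto
    have Nv: "nbrs E w \<inter> V = nbrs E w" for w using nbrs_sub by blast
    have e: "card E = card (induced E ?Q) + (\<Sum>w\<in>nbrs E v. card (nbrs E w))"
      using card_induced_split_nbrs[of V v] cubic_nbrs_indep[OF v] by (simp add: Nv)
    obtain a b c where abc: "nbrs E v = {a, b, c}" "a \<noteq> b" "a \<noteq> c" "b \<noteq> c"
      using v(2) by (auto simp: card_3_iff)
    have "{a, b, c} \<subseteq> V" using nbrs_sub[of v] abc(1) by simp
    then have "3 \<le> card (nbrs E a)" "3 \<le> card (nbrs E b)" "3 \<le> card (nbrs E c)"
      using min_degree by auto
    moreover have "card E = card (induced E ?Q) + (card (nbrs E a) + card (nbrs E b) + card (nbrs E c))"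
      using e abc by simp
    ultimately show ?thesis using q small unfolding abc(1) by auto
  qed
  obtain v where v: "v \<in> V" "card (nbrs E v) = 3"
    using exists_cubic small c12 by auto
  have c19: "card E = 19" using cubic[OF v] by simp
  define D where "D = {v \<in> V. card (nbrs E v) = 3}"
  have "D = V"
  proof (rule ccontr)
    assume "D \<noteq> V"
    then obtain x y where xy: "x \<in> D" "y \<in> V - D" "{x, y} \<in> E"
      using leaving_edge[of D] v by (auto simp: D_def)
    then show False using cubic[of x] by (auto simp: D_def)
  qed
  then have "(\<Sum>v\<in>V. card (nbrs E v)) = (\<Sum>v\<in>V. 3)"
    by (intro sum.cong) (auto simp: D_def)
  then show False using c12 c19 by (simp add: handshake)
qed

text \<open>Unlike on twelve vertices, degrees alone do not exclude triangles: 3 * 4 + 7 * 3 = 33 is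
  below 2 * 18. Only neighbourhoods of cubic vertices are known to be independent, and the edges
  around one cubic vertex \<open>v\<close> have to be distributed by hand.\<close>

lemma size_ge_10:
  assumes c10: "card V = 10"
  shows "19 \<le> card E"
proof (rule ccontr)
  assume "\<not> 19 \<le> card E"
  then have small: "card E \<le> 18" by simp
  have al: "alpha_le E V 3" using alpha c10 by simp
  have no_indep4: False
    if "{a, b, c, d} \<subseteq> V" "distinct [a, b, c, d]" "{a, b} \<notin> E" "{a, c} \<notin> E" "{a, d} \<notin> E"
      "{b, c} \<notin> E" "{b, d} \<notin> E" "{c, d} \<notin> E" for a b c d
  proof -
    have "indep E {a, b, c, d}" using that(3-) by (auto simp: indep_def insert_commute)
    then have "card {a, b, c, d} \<le> 3" using that(1) by (intro alpha_leD[OF al])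
    then show False using that(2) by simp
  qed
  have no_tri: False if "u \<in> V" "card (nbrs E u) = 3" "{u, a} \<in> E" "{u, b} \<in> E" "{a, b} \<in> E" for u a b
    using cubic_nbrs_indep[OF that(1,2)] that(3-5) by (auto simp: indep_def)
  obtain v where v: "v \<in> V" "card (nbrs E v) = 3"
    using exists_cubic small c10 by auto
  define N where "N = nbrs E v"
  define W where "W = V - insert v N"
  have NV: "N \<subseteq> V" and WV: "W \<subseteq> V" and finN: "finite N" and finW: "finite W"
    using nbrs_sub by (auto simp: N_def W_def)
  have cN: "card N = 3" and iN: "indep E N" using v cubic_nbrs_indep by (auto simp: N_def)
  have cW: "card W = 6" using degree_V_split[OF v(1)] v(2) c10 by (simp add: W_def N_def)
  have disj: "N \<inter> W = {}" "v \<notin> N" "v \<notin> W" by (auto simp: W_def N_def)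
  have vW: "{v, w} \<notin> E" if "w \<in> W" for w using that by (auto simp: W_def N_def)
  define f where "f w = card (nbrs E w \<inter> N)" for w
  define g where "g w = card (nbrs E w \<inter> W)" for w
  define S where "S = (\<Sum>n\<in>N. g n)"
  have degN: "card (nbrs E n) = Suc (g n)" if n: "n \<in> N" for n
  proof -
    have "nbrs E n = insert v (nbrs E n \<inter> W)"
    proof (intro equalityI subsetI)
      fix y assume y: "y \<in> nbrs E n"
      then have "y \<in> V" "y \<notin> N" using edgeD iN n by (auto simp: indep_def)
      then show "y \<in> insert v (nbrs E n \<inter> W)" using y by (auto simp: W_def)
    qed (use n in \<open>auto simp: N_def insert_commute\<close>)
    then have "card (nbrs E n) = card (insert v (nbrs E n \<inter> W))" by simp
    then show ?thesis using disj by (simp add: g_def)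
  qed
  have g2: "2 \<le> g n" if "n \<in> N" for n using degN[OF that] min_degree[of n] that NV by auto
  have degW: "card (nbrs E w) = f w + g w" if w: "w \<in> W" for w
  proof -
    have "nbrs E w = (nbrs E w \<inter> N) \<union> (nbrs E w \<inter> W)"
      using vW[OF w] nbrs_sub[of w] by (auto simp: W_def insert_commute)
    then have "card (nbrs E w) = card ((nbrs E w \<inter> N) \<union> (nbrs E w \<inter> W))" by simp
    also have "\<dots> = f w + g w"
      unfolding f_def g_def using disj finN finW by (intro card_Un_disjoint) auto
    finally show ?thesis .
  qed
  \<comment> \<open>A vertex of \<open>W\<close> without neighbour in \<open>N\<close> would extend
    \<open>N\<close> to four independent vertices.\<close>
  have f1: "1 \<le> f w" if w: "w \<in> W" for w
  proof (rule ccontr)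
    assume "\<not> 1 \<le> f w"
    then have "card (nbrs E w \<inter> N) = 0" unfolding f_def by linarith
    then have "nbrs E w \<inter> N = {}" using finN by simp
    then have "card (insert w N) \<le> 3"
      using w NV WV by (intro alpha_leD[OF al] indep_insert iN) auto
    moreover have "w \<notin> N" using w disj by auto
    ultimately show False using finN cN by simp
  qed
  have Nv: "nbrs E w \<inter> V = nbrs E w" for w using nbrs_sub by blast
  have "card E = card (induced E W) + (\<Sum>n\<in>N. card (nbrs E n))"
    using card_induced_split_nbrs[of V v] iN by (simp add: Nv N_def W_def)
  also have "(\<Sum>n\<in>N. card (nbrs E n)) = (\<Sum>n\<in>N. 1 + g n)"
    by (intro sum.cong) (auto simp: degN)
  also have "\<dots> = 3 + S" by (subst sum.distrib) (simp add: S_def cN)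
  finally have eE: "card E = card (induced E W) + 3 + S" by simp
  have Sf: "S = (\<Sum>w\<in>W. f w)"
    unfolding S_def f_def g_def by (rule cross_count[OF finN finW])
  have S6: "6 \<le> S"
  proof -
    have "(\<Sum>n\<in>N. 2) \<le> S" unfolding S_def by (rule sum_mono) (rule g2)
    then show ?thesis using cN by simp
  qed
  \<comment> \<open>Otherwise the two neighbours of \<open>n\<close> in \<open>W\<close> see nothing
    else of \<open>N\<close>; being non-adjacent, as \<open>n\<close> is cubic, they form with the
    other two elements of \<open>N\<close> an independent set of size 4.\<close>
  have f2: "\<exists>w\<in>W. {n, w} \<in> E \<and> 2 \<le> f w" if n: "n \<in> N" "g n = 2" for n
  proof (rule ccontr)
    assume no: "\<not> ?thesis"
    obtain p q where pq: "nbrs E n \<inter> W = {p, q}" "p \<noteq> q"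
      using n(2) by (auto simp: g_def card_2_iff)
    have "card (N - {n}) = 2" using n(1) cN finN by simp
    then obtain b c where bc: "N - {n} = {b, c}" "b \<noteq> c" by (auto simp: card_2_iff)
    have bcN: "b \<in> N" "c \<in> N" "b \<noteq> n" "c \<noteq> n" using bc by auto
    have pqW: "p \<in> W" "q \<in> W" "{n, p} \<in> E" "{n, q} \<in> E" using pq by auto
    have *: "{w, m} \<notin> E" if w: "w \<in> W" "{n, w} \<in> E" and m: "m \<in> N" "m \<noteq> n" for w m
    proof
      assume "{w, m} \<in> E"
      then have "{n, m} \<subseteq> nbrs E w \<inter> N" using w m n by (auto simp: insert_commute)
      then have "card {n, m} \<le> f w" unfolding f_def by (intro card_mono) auto
      then show False using no w m by auto
    qed
    have "{p, q} \<notin> E"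
      using no_tri[of n p q] degN[OF n(1)] n NV pqW by auto
    moreover have "{b, c} \<notin> E" using iN bcN by (auto simp: indep_def)
    moreover have "distinct [p, q, b, c]" using pq(2) bc(2) pqW bcN disj by auto
    moreover have "{p, q, b, c} \<subseteq> V" using pqW bcN NV WV by auto
    moreover have "{p, b} \<notin> E" "{p, c} \<notin> E" "{q, b} \<notin> E" "{q, c} \<notin> E"
      using * pqW bcN by auto
    ultimately show False by (intro no_indep4[of p q b c])
  qed
  \<comment> \<open>\<open>S\<close> is the number of edges between \<open>N\<close> and \<open>W\<close>; by \<open>eE\<close>, a large \<open>S\<close> leaves few edges
    inside \<open>W\<close>, while a small \<open>S\<close> contradicts \<open>f2\<close>.\<close>
  consider "S = 6" | "S = 7" | "8 \<le> S" using S6 by linarith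
  then show False
  proof cases
    case 1
    have "f w = 1" if w: "w \<in> W" for w
    proof (rule ccontr)
      assume "f w \<noteq> 1"
      then have "2 \<le> f w" using f1[OF w] by simp
      moreover have "S = f w + (\<Sum>w\<in>W - {w}. f w)" using w finW by (simp add: Sf sum.remove)
      moreover have "(\<Sum>w\<in>W - {w}. 1) \<le> (\<Sum>w\<in>W - {w}. f w)" by (rule sum_mono) (use f1 in auto)
      ultimately show False using 1 w cW finW by simp
    qed
    moreover obtain n where n: "n \<in> N" using cN by fastforce
    moreover have "g n = 2"
    proof (rule ccontr)
      assume "g n \<noteq> 2"
      then have "3 \<le> g n" using g2[OF n] by simp
      moreover have "S = g n + (\<Sum>m\<in>N - {n}. g m)" using n finN by (simp add: S_def sum.remove)
      moreover have "(\<Sum>m\<in>N - {n}. 2) \<le> (\<Sum>m\<in>N - {n}. g m)" by (rule sum_mono) (use g2 in auto)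
      ultimately show False using 1 n cN finN by simp
    qed
    ultimately show False using f2[of n] by auto
  next
    case 2
    \<comment> \<open>Six values \<open>f w \<ge> 1\<close> with sum 7 leave one exceeding 1; three
      values \<open>g n \<ge> 2\<close> with sum 7 leave two equal to 2.\<close>
    have uniq: False if ww: "w \<in> W" "w' \<in> W" "w \<noteq> w'" "2 \<le> f w" "2 \<le> f w'" for w w'
    proof -
      have "(\<Sum>u\<in>{w, w'}. 2) \<le> (\<Sum>u\<in>{w, w'}. f u)" by (rule sum_mono) (use ww in auto)
      moreover have "(\<Sum>u\<in>W - {w, w'}. 1) \<le> (\<Sum>u\<in>W - {w, w'}. f u)" by (rule sum_mono) (use f1 in auto)
      moreover have "S = (\<Sum>u\<in>W - {w, w'}. f u) + (\<Sum>u\<in>{w, w'}. f u)"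
        unfolding Sf using ww finW by (intro sum.subset_diff) auto
      moreover have "card (W - {w, w'}) = 4" using ww cW by (subst card_Diff_subset) auto
      moreover have "card {w, w'} = 2" using ww by simp
      ultimately show False using 2 by simp
    qed
    have uniqN: "g n = 2 \<or> g m = 2" if nm: "n \<in> N" "m \<in> N" "n \<noteq> m" for n m
    proof (rule ccontr)
      assume no: "\<not> ?thesis"
      have "(\<Sum>u\<in>{n, m}. 3) \<le> (\<Sum>u\<in>{n, m}. g u)"
        by (rule sum_mono) (use nm no g2[of n] g2[of m] in auto)
      moreover have "(\<Sum>u\<in>N - {n, m}. 2) \<le> (\<Sum>u\<in>N - {n, m}. g u)" by (rule sum_mono) (use g2 in auto)
      moreover have "S = (\<Sum>u\<in>N - {n, m}. g u) + (\<Sum>u\<in>{n, m}. g u)"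
        unfolding S_def using nm finN by (intro sum.subset_diff) auto
      moreover have "card (N - {n, m}) = 1" using nm cN by (subst card_Diff_subset) auto
      moreover have "card {n, m} = 2" using nm by simp
      ultimately show False using 2 by simp
    qed
    obtain x y z where xyz: "N = {x, y, z}" "x \<noteq> y" "x \<noteq> z" "y \<noteq> z" using cN by (auto simp: card_3_iff)
    obtain n n' n'' where nn: "N = {n, n', n''}" "n \<noteq> n'" "n \<noteq> n''" "n' \<noteq> n''" "g n = 2" "g n' = 2"
    proof (cases "g x = 2")
      case True
      then show ?thesis
        using that[of x y z] that[of x z y] uniqN[of y z] xyz by (auto simp: insert_commute)
    next
      case False
      then show ?thesis
        using that[of y z x] uniqN[of x y] uniqN[of x z] xyz by (auto simp: insert_commute)
    qed
    have nN: "n \<in> N" "n' \<in> N" "n'' \<in> N" using nn by auto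
    have nV: "n \<in> V" "n' \<in> V" "n'' \<in> V" using nN NV by auto
    have nni: "{n, n'} \<notin> E" using iN nN by (auto simp: indep_def)
    have dn: "card (nbrs E n) = 3" "card (nbrs E n') = 3" using degN nN nn by auto
    obtain s where s: "s \<in> W" "{n, s} \<in> E" "2 \<le> f s" using f2[OF nN(1)] nn by auto
    obtain s' where s': "s' \<in> W" "{n', s'} \<in> E" "2 \<le> f s'" using f2[OF nN(2)] nn by auto
    \<comment> \<open>\<open>f2\<close> leads from \<open>n\<close> and from \<open>n'\<close> to a
      vertex with two neighbours in \<open>N\<close>, and only one such vertex exists.\<close>
    have "s' = s" using uniq[of s s'] s s' by auto
    then have ns: "{n', s} \<in> E" using s' by simp
    have f1': "m = m'" if m: "w \<in> W" "w \<noteq> s" "{m, w} \<in> E" "{m', w} \<in> E" "m \<in> N" "m' \<in> N" for w m m'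
    proof (rule ccontr)
      assume ne: "m \<noteq> m'"
      have "{m, m'} \<subseteq> nbrs E w \<inter> N" using m by (auto simp: insert_commute)
      then have "card {m, m'} \<le> f w" unfolding f_def by (intro card_mono) auto
      then have "2 \<le> f w" using ne by simp
      then show False using uniq[of w s] m s by auto
    qed
    have other: "\<exists>a. nbrs E m \<inter> W = {s, a} \<and> a \<noteq> s" if m: "{m, s} \<in> E" "g m = 2" for m
    proof -
      have "card (nbrs E m \<inter> W - {s}) = 1" using m s by (simp add: g_def)
      then obtain a where a: "nbrs E m \<inter> W - {s} = {a}" by (rule card_1_singletonE)
      have "s \<in> nbrs E m \<inter> W" using m s by simp
      then have "nbrs E m \<inter> W = insert s (nbrs E m \<inter> W - {s})" by blast
      then show ?thesis using a by blast
    qed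
    obtain a where a: "nbrs E n \<inter> W = {s, a}" "a \<noteq> s" using other[OF s(2) nn(5)] by blast
    obtain b where b: "nbrs E n' \<inter> W = {s, b}" "b \<noteq> s" using other[OF ns nn(6)] by blast
    have "a \<in> nbrs E n \<inter> W" "b \<in> nbrs E n' \<inter> W" unfolding a(1) b(1) by auto
    then have aW: "a \<in> W" "{n, a} \<in> E" and bW: "b \<in> W" "{n', b} \<in> E" by auto
    have ab: "a \<noteq> b" using f1'[of a n n'] aW bW a(2) nN nn(2) by auto
    have sa: "{s, a} \<notin> E" using no_tri[OF nV(1) dn(1) s(2) aW(2)] by auto
    have sb: "{s, b} \<notin> E" using no_tri[OF nV(2) dn(2) ns bW(2)] by auto
    have abE: "{a, b} \<in> E"
    proof (rule ccontr)
      assume "{a, b} \<notin> E"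
      then show False
        by (intro no_indep4[of v s a b])
          (use sa sb ab a(2) b(2) aW bW s(1) v(1) WV vW disj in auto)
    qed
    define C where "C = W - {s, a, b}"
    have CW: "C \<subseteq> W" and finC: "finite C" using finW by (auto simp: C_def)
    have cC: "card C = 3" unfolding C_def using s(1) aW(1) bW(1) ab a(2) b(2) cW by (subst card_Diff_subset) auto
    have C_nn: "{n, p} \<notin> E" "{n', p} \<notin> E" if "p \<in> C" for p
    proof -
      have "p \<notin> nbrs E n \<inter> W" "p \<notin> nbrs E n' \<inter> W" "p \<in> W"
        unfolding a(1) b(1) using that by (auto simp: C_def)
      then show "{n, p} \<notin> E" "{n', p} \<notin> E" by auto
    qed
    have C_clique: "{p, q} \<in> E" if pq: "p \<in> C" "q \<in> C" "p \<noteq> q" for p q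
    proof (rule ccontr)
      assume "{p, q} \<notin> E"
      moreover have "distinct [n, n', p, q]" using pq nn(2) nN CW disj by auto
      moreover have "{n, n', p, q} \<subseteq> V" using nV pq CW WV by auto
      ultimately show False using nni C_nn pq by (intro no_indep4[of n n' p q])
    qed
    have p_sa: "{s, p} \<in> E \<or> {a, p} \<in> E" if p: "p \<in> C" for p
    proof (rule ccontr)
      assume "\<not> ?thesis"
      moreover have "p \<in> W" "p \<notin> {s, a, b}" using p by (auto simp: C_def)
      ultimately show False
        by (intro no_indep4[of v s a p]) (use sa aW a(2) s(1) v(1) WV vW disj in auto)
    qed
    have p_sb: "{s, p} \<in> E \<or> {b, p} \<in> E" if p: "p \<in> C" for p
    proof (rule ccontr)
      assume "\<not> ?thesis"
      moreover have "p \<in> W" "p \<notin> {s, a, b}" using p by (auto simp: C_def)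
      ultimately show False
        by (intro no_indep4[of v s b p]) (use sb bW b(2) s(1) v(1) WV vW disj in auto)
    qed
    define A B Z where "A = nbrs E a \<inter> C" and "B = nbrs E b \<inter> C" and "Z = nbrs E s \<inter> C"
    have fin: "finite A" "finite B" "finite Z" using finC by (auto simp: A_def B_def Z_def)
    have only: "nbrs E a \<subseteq> insert n (insert b A)"
    proof
      fix y assume y: "y \<in> nbrs E a"
      have "y \<in> V" "y \<noteq> v" "y \<noteq> a" "y \<noteq> s"
        using y edgeD vW[OF aW(1)] sa by (auto simp: insert_commute)
      moreover have "y = n" if "y \<in> N"
        using f1'[of a y n] that y aW a nN by (auto simp: insert_commute)
      ultimately show "y \<in> insert n (insert b A)" using y by (auto simp: A_def C_def W_def)
    qed
    have onlyb: "nbrs E b \<subseteq> insert n' (insert a B)"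
    proof
      fix y assume y: "y \<in> nbrs E b"
      have "y \<in> V" "y \<noteq> v" "y \<noteq> b" "y \<noteq> s"
        using y edgeD vW[OF bW(1)] sb by (auto simp: insert_commute)
      moreover have "y = n'" if "y \<in> N"
        using f1'[of b y n'] that y bW b nN by (auto simp: insert_commute)
      ultimately show "y \<in> insert n' (insert a B)" using y by (auto simp: B_def C_def W_def)
    qed
    have A1: "A \<noteq> {}" using only three_nbrs[of a n b] aW WV by auto
    have B1: "B \<noteq> {}" using onlyb three_nbrs[of b n' a] bW WV by auto
    \<comment> \<open>A vertex of \<open>C\<close> not adjacent to \<open>s\<close> must be adjacent
      to both \<open>a\<close> and \<open>b\<close>, or an independent set containing
      \<open>v\<close>, \<open>s\<close> and one of them has four elements.\<close>
    have cov: "C \<subseteq> Z \<union> (A \<inter> B)"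
      using p_sa p_sb unfolding A_def B_def Z_def nbrs_def by blast
    \<comment> \<open>Removing \<open>s\<close>, \<open>a\<close>, \<open>b\<close> in turn counts
      \<open>card Z\<close>, then \<open>card A + 1\<close> (the edge \<open>a b\<close>), then
      \<open>card B\<close>, and at least 3 edges remain in \<open>C\<close>. As
      \<open>S = 7\<close>, at most 8 edges are available in \<open>W\<close>.\<close>
    have "card (induced E W) = card (induced E (W - {s})) + card (nbrs E s \<inter> W)"
      using card_induced_split[of "{s}" W] s WV by (simp add: indep_def)
    moreover have "nbrs E s \<inter> W = Z" using sa sb by (auto simp: Z_def C_def)
    moreover have "card (induced E (W - {s})) =
        card (induced E (W - {s} - {a})) + card (nbrs E a \<inter> (W - {s}))"
      using card_induced_split[of "{a}" "W - {s}"] aW(1) a(2) WV by (auto simp: indep_def)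
    moreover have "nbrs E a \<inter> (W - {s}) = insert b A"
      using abE bW(1) b(2) by (auto simp: A_def C_def)
    moreover have "card (insert b A) = Suc (card A)" using fin by (simp add: A_def C_def)
    moreover have "card (induced E (W - {s} - {a})) =
        card (induced E (W - {s} - {a} - {b})) + card (nbrs E b \<inter> (W - {s} - {a}))"
      using card_induced_split[of "{b}" "W - {s} - {a}"] bW(1) b(2) ab WV by (auto simp: indep_def)
    moreover have "nbrs E b \<inter> (W - {s} - {a}) = B" by (auto simp: B_def C_def)
    moreover have "W - {s} - {a} - {b} = C" by (auto simp: C_def)
    moreover have "3 \<le> card (induced E C)"
    proof -
      have "2 \<le> card (nbrs E p \<inter> C)" if p: "p \<in> C" for p
      proof -
        have "C - {p} \<subseteq> nbrs E p \<inter> C" using C_clique p unfolding nbrs_def by blast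
        then have "card (C - {p}) \<le> card (nbrs E p \<inter> C)" by (intro card_mono) auto
        then show ?thesis using p cC finC by simp
      qed
      then have "(\<Sum>p\<in>C. 2) \<le> (\<Sum>p\<in>C. card (nbrs E p \<inter> C))" by (rule sum_mono)
      then show ?thesis using handshake_induced[of C] CW WV cC by simp
    qed
    ultimately have X: "card A + card B + card Z \<le> 4" using eE small 2 by simp
    have "card C \<le> card (Z \<union> (A \<inter> B))" using cov fin by (intro card_mono) auto
    also have "\<dots> \<le> card Z + card (A \<inter> B)" by (rule card_Un_le)
    finally have cov': "3 \<le> card Z + card (A \<inter> B)" using cC by simp
    have "card (A \<inter> B) \<le> card A" "card (A \<inter> B) \<le> card B" using fin by (auto intro: card_mono)
    moreover have "1 \<le> card A" "1 \<le> card B" using A1 B1 fin by (auto simp: Suc_le_eq card_gt_0_iff)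
    \<comment> \<open>If \<open>x = card (A \<inter> B)\<close>, then
      \<open>card Z \<ge> 3 - x\<close> leaves \<open>card A + card B \<le> x + 1\<close>, while
      both are at least \<open>x\<close> and at least 1. The result is a triangle
      \<open>a b p\<close> at the cubic vertex \<open>a\<close>.\<close>
    ultimately have "card A = 1" "card (A \<inter> B) = 1" using X cov' by linarith+
    then obtain p where p: "A = {p}" "p \<in> B" by (metis Int_iff card_1_singletonE insertI1 singletonD)
    have "card (nbrs E a) \<le> card {n, b, p}" using only unfolding p(1) by (intro card_mono) auto
    also have "\<dots> \<le> 3" by (simp add: card_insert_if)
    finally have da: "card (nbrs E a) = 3" using min_degree[of a] aW WV by auto
    have "p \<in> A" "p \<in> B" using p by simp_all
    then have "{a, p} \<in> E" "{b, p} \<in> E" by (auto simp: A_def B_def)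
    then show False using no_tri[of a b p] aW(1) WV da abE by auto
  next
    case 3
    then have eW: "card (induced E W) \<le> 7" using eE small by simp
    \<comment> \<open>Degrees of at least 4 on \<open>W\<close> need a sum of 24, but
      \<open>S + card (induced E W) \<le> 15\<close> and \<open>card (induced E W) \<le> 7\<close>
      allow only 22.\<close>
    have "\<exists>w\<in>W. card (nbrs E w) = 3"
    proof (rule ccontr)
      assume no: "\<not> ?thesis"
      have "4 \<le> f w + g w" if w: "w \<in> W" for w
      proof -
        have "3 \<le> card (nbrs E w)" "card (nbrs E w) \<noteq> 3" using no w WV min_degree by auto
        then show ?thesis using degW[OF w] by simp
      qed
      then have "(\<Sum>w\<in>W. 4) \<le> (\<Sum>w\<in>W. f w + g w)" by (rule sum_mono)
      also have "\<dots> = S + 2 * card (induced E W)"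
        unfolding g_def using handshake_induced[OF WV] by (simp add: sum.distrib Sf)
      finally have "24 \<le> S + 2 * card (induced E W)" using cW by simp
      then show False using eE small eW by simp
    qed
    then obtain w where w: "w \<in> W" "card (nbrs E w) = 3" by auto
    have wV: "w \<in> V" using w WV by auto
    have iw: "indep E (nbrs E w)" using cubic_nbrs_indep[OF wV w(2)] .
    define C where "C = W - insert w (nbrs E w)"
    have CW: "C \<subseteq> W" and finC: "finite C" using finW by (auto simp: C_def)
    have cC: "6 = Suc (g w + card C)"
      using card_partition_nbrs[OF w(1) finW] cW by (simp add: C_def g_def)
    \<comment> \<open>With \<open>v\<close> and \<open>w\<close>, two non-adjacent vertices of
      \<open>C\<close> would be four independent ones. So \<open>C\<close> is a clique on
      \<open>5 - g w\<close> vertices, to be fitted into the seven edges of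
      \<open>W\<close>.\<close>
    have C_clique: "{p, q} \<in> E" if pq: "p \<in> C" "q \<in> C" "p \<noteq> q" for p q
    proof (rule ccontr)
      assume "{p, q} \<notin> E"
      moreover have "distinct [v, w, p, q]" using pq w CW disj by (auto simp: C_def)
      moreover have "{w, p} \<notin> E" "{w, q} \<notin> E" using pq by (auto simp: C_def)
      moreover have "{v, w, p, q} \<subseteq> V" using v(1) wV pq CW WV by auto
      ultimately show False using vW w(1) pq CW by (intro no_indep4[of v w p q]) auto
    qed
    have eC: "2 * card (induced E C) = card C * (card C - 1)"
    proof -
      have "card (nbrs E p \<inter> C) = card C - 1" if p: "p \<in> C" for p
      proof -
        have "C - {p} \<subseteq> nbrs E p \<inter> C" using C_clique p unfolding nbrs_def by blast
        then have "nbrs E p \<inter> C = C - {p}" using not_self_nbr[of p] by blast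
        then show ?thesis using p finC by simp
      qed
      then have "(\<Sum>p\<in>C. card (nbrs E p \<inter> C)) = (\<Sum>p\<in>C. card C - 1)" by (intro sum.cong) auto
      then show ?thesis using handshake_induced[of C] CW WV by simp
    qed
    have "indep E (nbrs E w \<inter> W)" using iw by (rule indep_subset) auto
    then have split: "card (induced E W) = card (induced E C) + (\<Sum>y\<in>nbrs E w \<inter> W. g y)"
      using card_induced_split_nbrs[OF WV] by (simp add: C_def g_def)
    have "g w \<le> 2" using f1[OF w(1)] degW[OF w(1)] w(2) by simp
    then consider "g w = 0" | "g w = 1" | "g w = 2" by linarith
    then show False
    proof cases
      case 1
      then have "card C = 5" using cC by simp
      then show False using eC split eW by simp
    next
      case 2
      then have "card C = 4" using cC by simp
      then have e6: "card (induced E C) = 6" using eC by simp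
      obtain y where y: "nbrs E w \<inter> W = {y}" using 2 by (auto simp: g_def card_1_singleton_iff)
      then have yW: "y \<in> W" and wy: "{w, y} \<in> E" by auto
      \<comment> \<open>The clique takes six of the seven edges, so \<open>w\<close> is the only
        neighbour of \<open>y\<close> in \<open>W\<close>. Then \<open>y\<close> and
        \<open>w\<close> both have at least two of the three vertices of \<open>N\<close> as
        neighbours and share one, which gives a triangle at the cubic vertex
        \<open>w\<close>.\<close>
      have "g y \<le> 1" using split y e6 eW by simp
      then have "2 \<le> f y" using degW[OF yW] min_degree[of y] yW WV by auto
      moreover have "f w = 2" using degW[OF w(1)] w(2) 2 by simp
      moreover have "f w + f y = card (nbrs E w \<inter> N \<union> nbrs E y \<inter> N) + card ((nbrs E w \<inter> N) \<inter> (nbrs E y \<inter> N))"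
        unfolding f_def using finN by (intro card_Un_Int) auto
      moreover have "card (nbrs E w \<inter> N \<union> nbrs E y \<inter> N) \<le> 3"
        using card_mono[OF finN, of "nbrs E w \<inter> N \<union> nbrs E y \<inter> N"] cN by auto
      ultimately have "card ((nbrs E w \<inter> N) \<inter> (nbrs E y \<inter> N)) \<noteq> 0" by linarith
      then have "(nbrs E w \<inter> N) \<inter> (nbrs E y \<inter> N) \<noteq> {}" by (metis card.empty)
      then obtain m where "{w, m} \<in> E" "{y, m} \<in> E" by auto
      then show False using no_tri[OF wV w(2) wy] by auto
    next
      case 3
      then have c3: "card C = 3" using cC by simp
      then have e3: "card (induced E C) = 3" using eC by simp
      obtain a b where ab: "nbrs E w \<inter> W = {a, b}" "a \<noteq> b" using 3 by (auto simp: g_def card_2_iff)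
      have aW: "a \<in> W" "{w, a} \<in> E" and bW: "b \<in> W" "{w, b} \<in> E" using ab by auto
      have abE: "{a, b} \<notin> E" using no_tri[OF wV w(2) aW(2) bW(2)] by auto
      \<comment> \<open>A vertex of \<open>C\<close> missing \<open>a\<close> and \<open>b\<close>
        would be independent of \<open>v\<close>, \<open>a\<close>, \<open>b\<close>. So three edges
        join \<open>{a, b}\<close> to \<open>C\<close>; with \<open>w a\<close>, \<open>w b\<close>
        and the triangle \<open>C\<close> there are eight in \<open>W\<close>.\<close>
      have cov: "C \<subseteq> (nbrs E a \<inter> C) \<union> (nbrs E b \<inter> C)"
      proof
        fix p assume p: "p \<in> C"
        then have pW: "p \<in> W" "p \<noteq> a" "p \<noteq> b" using aW bW by (auto simp: C_def)
        have "{a, p} \<in> E \<or> {b, p} \<in> E"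
        proof (rule ccontr)
          assume "\<not> ?thesis"
          then show False
            by (intro no_indep4[of v a b p]) (use pW ab(2) aW bW abE v(1) WV vW disj in auto)
        qed
        then show "p \<in> (nbrs E a \<inter> C) \<union> (nbrs E b \<inter> C)" using p by auto
      qed
      have "card C \<le> card ((nbrs E a \<inter> C) \<union> (nbrs E b \<inter> C))" using cov by (intro card_mono) auto
      also have "\<dots> \<le> card (nbrs E a \<inter> C) + card (nbrs E b \<inter> C)" by (rule card_Un_le)
      finally have "3 \<le> card (nbrs E a \<inter> C) + card (nbrs E b \<inter> C)" using c3 by simp
      moreover have "Suc (card (nbrs E y \<inter> C)) \<le> g y" if y: "{w, y} \<in> E" for y
      proof -
        have "insert w (nbrs E y \<inter> C) \<subseteq> nbrs E y \<inter> W" using y w(1) CW by (auto simp: insert_commute)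
        then have "card (insert w (nbrs E y \<inter> C)) \<le> g y" unfolding g_def by (intro card_mono) auto
        moreover have "w \<notin> C" by (simp add: C_def)
        ultimately show ?thesis by simp
      qed
      then have "Suc (card (nbrs E a \<inter> C)) \<le> g a" "Suc (card (nbrs E b \<inter> C)) \<le> g b" using aW bW by auto
      ultimately have "8 \<le> card (induced E W)" using split e3 ab by simp
      then show False using eW by simp
    qed
  qed
qed

end

section \<open>Insertion of rungs\<close>

lemma bipartite_iff:
  assumes "simple_graph V E"
  shows "bipartite V E \<longleftrightarrow> (\<exists>A. \<forall>x y. {x, y} \<in> E \<longrightarrow> (x \<in> A \<longleftrightarrow> y \<notin> A))"
proof
  assume "bipartite V E"
  then obtain A B where AB: "A \<inter> B = {}" "\<And>e. e \<in> E \<Longrightarrow> \<exists>a\<in>A. \<exists>b\<in>B. e = {a, b}"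
    unfolding bipartite_def by metis
  have "x \<in> A \<longleftrightarrow> y \<notin> A" if "{x, y} \<in> E" for x y
    using AB(1) AB(2)[OF that] by (auto simp: doubleton_eq_iff)
  then show "\<exists>A. \<forall>x y. {x, y} \<in> E \<longrightarrow> (x \<in> A \<longleftrightarrow> y \<notin> A)" by blast
next
  assume "\<exists>A. \<forall>x y. {x, y} \<in> E \<longrightarrow> (x \<in> A \<longleftrightarrow> y \<notin> A)"
  then obtain A where A: "\<And>x y. {x, y} \<in> E \<Longrightarrow> x \<in> A \<longleftrightarrow> y \<notin> A" by blast
  interpret sgraph V E by unfold_locales (rule assms)
  have "\<exists>a\<in>A \<inter> V. \<exists>b\<in>V - A. e = {a, b}" if e: "e \<in> E" for e
  proof -
    obtain x y where xy: "e = {x, y}" by (rule edge_pair[OF e])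
    have "x \<in> V" "y \<in> V" using e xy edgeD by auto
    then show ?thesis using A[of x y] e xy by (cases "x \<in> A") (auto simp: insert_commute)
  qed
  then show "bipartite V E"
    unfolding bipartite_def by (intro exI[of _ "A \<inter> V"] exI[of _ "V - A"]) auto
qed

text \<open>
  In the 4-cycle \<open>a b d c\<close> the rails \<open>a b\<close> and \<open>c d\<close> become the paths \<open>a p q b\<close> and \<open>c r s d\<close>,
  and \<open>p r\<close>, \<open>q s\<close> are the new rungs, parallel to \<open>a c\<close> and \<open>b d\<close>.
\<close>

definition insert_rungs ::
    "'a set set \<Rightarrow> 'a \<Rightarrow> 'a \<Rightarrow> 'a \<Rightarrow> 'a \<Rightarrow> 'a \<Rightarrow> 'a \<Rightarrow> 'a \<Rightarrow> 'a \<Rightarrow> 'a set set" where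
  "insert_rungs E a b c d p q r s =
     (E - {{a, b}, {c, d}}) \<union>
     {{a, p}, {p, q}, {q, b}, {c, r}, {r, s}, {s, d}, {p, r}, {q, s}}"

text \<open>Without the chords \<open>a d\<close> and \<open>b c\<close>, the only old edges meeting
  both \<open>{a, c}\<close> and \<open>{b, d}\<close>, apart from these two themselves, are the
  rails.\<close>

definition rung_frame ::
    "'a set \<Rightarrow> 'a set set \<Rightarrow> 'a \<Rightarrow> 'a \<Rightarrow> 'a \<Rightarrow> 'a \<Rightarrow> 'a \<Rightarrow> 'a \<Rightarrow> 'a \<Rightarrow> 'a \<Rightarrow> bool" where
  "rung_frame V E a b c d p q r s \<longleftrightarrow>
     {a, b} \<in> E \<and> {c, d} \<in> E \<and> {a, c} \<in> E \<and> {b, d} \<in> E \<and> {a, d} \<notin> E \<and> {b, c} \<notin> E \<and>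
     distinct [a, b, c, d, p, q, r, s] \<and> {a, b, c, d} \<subseteq> V \<and> {p, q, r, s} \<inter> V = {}"

text \<open>Reversal and the swap of the rails generate four symmetries carrying \<open>a p\<close>
  to each of the four edges between old and new vertices, so only \<open>a p\<close> needs a direct
  treatment.\<close>

lemma insert_rungs_rev: "insert_rungs E b a d c q p s r = insert_rungs E a b c d p q r s"
  unfolding insert_rungs_def by (simp add: insert_commute)

lemma insert_rungs_swap: "insert_rungs E c d a b r s p q = insert_rungs E a b c d p q r s"
  unfolding insert_rungs_def by (simp add: insert_commute)

lemma rung_frame_rev: "rung_frame V E a b c d p q r s \<Longrightarrow> rung_frame V E b a d c q p s r"
  unfolding rung_frame_def by (auto simp: insert_commute)

lemma rung_frame_swap: "rung_frame V E a b c d p q r s \<Longrightarrow> rung_frame V E c d a b r s p q"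
  unfolding rung_frame_def by (auto simp: insert_commute)

lemma matchable_insert_eq:
  assumes "matchable E Y" "{u, v} \<in> E" "u \<notin> Y" "v \<notin> Y" "X = insert u (insert v Y)"
  shows "matchable E X"
  using matchable_insert[OF assms(1-4)] assms(5) by simp

lemma matchable_avoiding:
  assumes "perfect_matching Y E P" "P \<subseteq> F"
  shows "matchable F Y"
  using assms unfolding matchable_def perfect_matching_def matching_def by blast

context ext2
begin

lemma matchable_remove_edge:
  assumes "e \<in> E"
  shows "matchable E (V - e)"
proof -
  obtain u v where uv: "e = {u, v}" by (rule edge_pair[OF assms])
  then obtain P where "perfect_matching V E P" "{u, v} \<in> P"
    using matching_edge assms by metis
  then show ?thesis using perfect_matching_remove uv unfolding matchable_def by metis
qed

lemma matchable_remove_edges: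
  assumes "e \<in> E" "f \<in> E" "e \<inter> f = {}"
  shows "matchable E (V - e - f)"
proof -
  obtain u v where e: "e = {u, v}" by (rule edge_pair[OF assms(1)])
  obtain w z where f: "f = {w, z}" by (rule edge_pair[OF assms(2)])
  obtain P where P: "perfect_matching V E P" "e \<in> P" "f \<in> P"
    using matching_pair[of u v w z] assms unfolding e f by metis
  have "e \<noteq> f" using assms(3) e by auto
  then have "f \<in> P - {e}" using P by auto
  then show ?thesis
    using perfect_matching_remove[OF perfect_matching_remove[OF P(1,2)]] unfolding matchable_def by blast
qed

end

section \<open>Perfect matchings after the insertion of two rungs\<close>

locale ladder = ext2 V E for V :: "'a set" and E :: "'a set set" +
  fixes a b c d p q r s :: 'a
  assumes frame: "rung_frame V E a b c d p q r s"
begin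

abbreviation "E' \<equiv> insert_rungs E a b c d p q r s"
abbreviation "V' \<equiv> V \<union> {p, q, r, s}"

lemma rail_edges: "{a, b} \<in> E" "{c, d} \<in> E" "{a, c} \<in> E" "{b, d} \<in> E" "{a, d} \<notin> E" "{b, c} \<notin> E"
  and corners: "a \<in> V" "b \<in> V" "c \<in> V" "d \<in> V"
  and fresh: "p \<notin> V" "q \<notin> V" "r \<notin> V" "s \<notin> V"
  and corners_distinct: "a \<noteq> b" "a \<noteq> c" "a \<noteq> d" "b \<noteq> c" "b \<noteq> d" "c \<noteq> d"
  and fresh_distinct: "p \<noteq> q" "p \<noteq> r" "p \<noteq> s" "q \<noteq> r" "q \<noteq> s" "r \<noteq> s"
  using frame by (auto simp: rung_frame_def)

lemma new_edges:
  "{a, p} \<in> E'" "{p, q} \<in> E'" "{q, b} \<in> E'" "{c, r} \<in> E'" "{r, s} \<in> E'" "{s, d} \<in> E'"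
  "{p, r} \<in> E'" "{q, s} \<in> E'" "{a, c} \<in> E'" "{b, d} \<in> E'"
  using rail_edges corners_distinct by (auto simp: insert_rungs_def doubleton_eq_iff)

lemma old_edge: "e \<in> E \<Longrightarrow> e \<noteq> {a, b} \<Longrightarrow> e \<noteq> {c, d} \<Longrightarrow> e \<in> E'"
  by (auto simp: insert_rungs_def)

lemma ladder_rev: "ladder V E b a d c q p s r"
  by unfold_locales (rule rung_frame_rev[OF frame])

lemma ladder_swap: "ladder V E c d a b r s p q"
  by unfold_locales (rule rung_frame_swap[OF frame])

lemma not_in_matching: "perfect_matching Y F P \<Longrightarrow> x \<notin> Y \<Longrightarrow> {x, y} \<notin> P \<and> {y, x} \<notin> P"
  by (auto simp: perfect_matching_def)

lemma matching_sub: "perfect_matching Y F P \<Longrightarrow> P \<subseteq> F"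
  by (auto simp: perfect_matching_def matching_def)

text \<open>A perfect matching of \<open>Y\<close> cannot use a rail, and all other old edges
  survive.\<close>

lemma lift0:
  assumes Y: "matchable E Y" "a \<notin> Y \<or> b \<notin> Y" "c \<notin> Y \<or> d \<notin> Y"
  shows "matchable E' Y"
proof -
  obtain P where P: "perfect_matching Y E P" using Y(1) by (auto simp: matchable_def)
  have "{a, b} \<notin> P" "{c, d} \<notin> P" using not_in_matching[OF P] Y(2,3) by blast+
  then have "P \<subseteq> E'" using matching_sub[OF P] old_edge by blast
  then show ?thesis by (rule matchable_avoiding[OF P])
qed

text \<open>If the matching uses the rail \<open>c d\<close>, the edges \<open>c r\<close> and
  \<open>s d\<close> replace it; otherwise \<open>r s\<close> is added.\<close>

lemma lift_rs:
  assumes Y: "Y \<subseteq> V" "matchable E Y" "a \<notin> Y \<or> b \<notin> Y"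
  shows "matchable E' (Y \<union> {r, s})"
proof -
  obtain P where P: "perfect_matching Y E P" using Y(2) by (auto simp: matchable_def)
  have rsY: "r \<notin> Y" "s \<notin> Y" using fresh Y(1) by auto
  have ab: "{a, b} \<notin> P" using not_in_matching[OF P] Y(3) by blast
  show ?thesis
  proof (cases "{c, d} \<in> P")
    case True
    have cdY: "c \<in> Y" "d \<in> Y" using True P by (auto simp: perfect_matching_def)
    have "matchable E (Y - {c, d})"
      using perfect_matching_remove[OF P True] by (auto simp: matchable_def)
    then have "matchable E' (Y - {c, d})" by (rule lift0) (use Y in auto)
    then have "matchable E' (insert c (insert r (Y - {c, d})))"
      by (rule matchable_insert) (use new_edges rsY in auto)
    then show ?thesis
      by (rule matchable_insert_eq[of _ _ s d])
        (use new_edges rsY cdY corners fresh fresh_distinct corners_distinct in auto)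
  next
    case False
    then have "P \<subseteq> E'" using ab matching_sub[OF P] old_edge by blast
    then have "matchable E' Y" by (rule matchable_avoiding[OF P])
    then show ?thesis
      by (rule matchable_insert_eq[of _ _ r s]) (use new_edges rsY in auto)
  qed
qed

lemma lift_pq:
  assumes "Y \<subseteq> V" "matchable E Y" "c \<notin> Y \<or> d \<notin> Y"
  shows "matchable E' (Y \<union> {p, q})"
  using ladder.lift_rs[OF ladder_swap assms] insert_rungs_swap[of E c d a b r s p q] by simp

lemma lift_all:
  assumes Y: "Y \<subseteq> V" "matchable E Y"
  shows "matchable E' (Y \<union> {p, q, r, s})"
proof -
  obtain P where P: "perfect_matching Y E P" using Y(2) by (auto simp: matchable_def)
  have fY: "p \<notin> Y" "q \<notin> Y" "r \<notin> Y" "s \<notin> Y" using fresh Y(1) by auto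
  note facts = new_edges fY corners fresh fresh_distinct corners_distinct
  consider "{a, b} \<in> P" | "{c, d} \<in> P" | "{a, b} \<notin> P" "{c, d} \<notin> P" by blast
  then show ?thesis
  proof cases
    case 1
    have abY: "a \<in> Y" "b \<in> Y" using 1 P by (auto simp: perfect_matching_def)
    have "matchable E (Y - {a, b})"
      using perfect_matching_remove[OF P 1] by (auto simp: matchable_def)
    then have "matchable E' ((Y - {a, b}) \<union> {r, s})" by (intro lift_rs) (use Y in auto)
    then have "matchable E' (insert a (insert p ((Y - {a, b}) \<union> {r, s})))"
      by (rule matchable_insert) (use facts in auto)
    then show ?thesis
      by (rule matchable_insert_eq[of _ _ q b]) (use facts abY in auto)
  next
    case 2
    have cdY: "c \<in> Y" "d \<in> Y" using 2 P by (auto simp: perfect_matching_def)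
    have "matchable E (Y - {c, d})"
      using perfect_matching_remove[OF P 2] by (auto simp: matchable_def)
    then have "matchable E' ((Y - {c, d}) \<union> {p, q})" by (intro lift_pq) (use Y in auto)
    then have "matchable E' (insert c (insert r ((Y - {c, d}) \<union> {p, q})))"
      by (rule matchable_insert) (use facts in auto)
    then show ?thesis
      by (rule matchable_insert_eq[of _ _ s d]) (use facts cdY in auto)
  next
    case 3
    then have "P \<subseteq> E'" using matching_sub[OF P] old_edge by blast
    then have "matchable E' Y" by (rule matchable_avoiding[OF P])
    then have "matchable E' (insert p (insert r Y))"
      by (rule matchable_insert) (use facts in auto)
    then show ?thesis
      by (rule matchable_insert_eq[of _ _ q s]) (use facts in auto)
  qed
qed

text \<open>With \<open>p\<close> removed, \<open>q\<close> must go to \<open>b\<close> or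
  \<open>s\<close>. If \<open>b\<close> is free, an old matching through \<open>e\<close> and the
  rail \<open>a b\<close> gives \<open>q b\<close>; otherwise one through \<open>e\<close> and
  \<open>a c\<close> gives \<open>c r\<close> and \<open>q s\<close>.\<close>

lemma old_ap:
  assumes e: "e \<in> E" "e \<inter> {a, p} = {}"
  shows "matchable E' (V' - e - {a, p})"
proof -
  have eV: "e \<subseteq> V" by (rule edge_sub[OF e(1)])
  note facts = new_edges corners fresh fresh_distinct corners_distinct
  show ?thesis
  proof (cases "b \<in> e")
    case False
    then have "matchable E (V - e - {a, b})"
      using e by (intro matchable_remove_edges rail_edges) auto
    then have "matchable E' ((V - e - {a, b}) \<union> {r, s})" by (intro lift_rs) auto
    then show ?thesis
      by (rule matchable_insert_eq[of _ _ q b]) (use facts False e eV in auto)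
  next
    case True
    obtain z where z: "e = {b, z}"
      using edge_pair[OF e(1)] True by (metis insertE insert_commute singletonD)
    have za: "z \<noteq> a" "z \<noteq> c" "z \<in> V" "z \<noteq> b" using e z rail_edges edgeD[of b z] by auto
    then have "e \<inter> {a, c} = {}" using z corners_distinct by auto
    then have "matchable E (V - e - {a, c})"
      using e by (intro matchable_remove_edges rail_edges)
    then have "matchable E' (V - e - {a, c})" by (rule lift0) auto
    then have "matchable E' (insert c (insert r (V - e - {a, c})))"
      by (rule matchable_insert) (use facts in auto)
    then show ?thesis
      by (rule matchable_insert_eq[of _ _ q s]) (use facts z za in auto)
  qed
qed

text \<open>Being neither rail nor chord, \<open>e\<close> misses one of the rungs
  \<open>a c\<close>, \<open>b d\<close>. An old perfect matching through \<open>e\<close> and that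
  rung uses no rail, and the two new vertices still uncovered are adjacent.\<close>

lemma old_inner:
  assumes e: "e \<in> E" "e \<noteq> {a, b}" "e \<noteq> {c, d}"
  shows "matchable E' (V' - e - {p, q})" "matchable E' (V' - e - {p, r})"
proof -
  have eV: "e \<subseteq> V" by (rule edge_sub[OF e(1)])
  note facts = new_edges corners fresh fresh_distinct corners_distinct
  have "e \<inter> {a, c} = {} \<or> e \<inter> {b, d} = {}"
  proof (rule ccontr)
    assume no: "\<not> ?thesis"
    obtain u v where uv: "e = {u, v}" by (rule edge_pair[OF e(1)])
    then have "e = {a, b} \<or> e = {c, d} \<or> e = {a, d} \<or> e = {b, c}"
      using no corners_distinct by (auto simp: insert_commute)
    then show False using e rail_edges by auto
  qed
  then obtain x y where xy: "{x, y} \<in> E" "{x, y} \<in> E'" "e \<inter> {x, y} = {}"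
    "x = a \<and> y = c \<or> x = b \<and> y = d"
    using rail_edges new_edges by blast
  have xyV: "x \<in> V" "y \<in> V" "x \<noteq> y" using xy(1) edgeD by auto
  have "matchable E (V - e - {x, y})" using e xy by (intro matchable_remove_edges)
  then have "matchable E' (V - e - {x, y})" by (rule lift0) (use xy in auto)
  then have "matchable E' (insert x (insert y (V - e - {x, y})))"
    by (rule matchable_insert) (use xy in auto)
  moreover have "insert x (insert y (V - e - {x, y})) = V - e" using xyV xy(3) by auto
  ultimately have Ve: "matchable E' (V - e)" by simp
  show "matchable E' (V' - e - {p, q})"
    by (rule matchable_insert_eq[OF Ve, of r s]) (use facts eV in auto)
  show "matchable E' (V' - e - {p, r})"
    by (rule matchable_insert_eq[OF Ve, of q s]) (use facts eV in auto)
qed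

lemma matchable_V: "matchable E' V"
proof -
  have "matchable E (V - {a, c})" by (rule matchable_remove_edge[OF rail_edges(3)])
  then have "matchable E' (V - {a, c})" by (rule lift0) auto
  then show ?thesis
    by (rule matchable_insert_eq[of _ _ a c])
      (use new_edges corners in auto)
qed

lemma new_inner: "matchable E' (V' - {p, q} - {r, s})" "matchable E' (V' - {p, r} - {q, s})"
proof -
  have "V' - {p, q} - {r, s} = V" "V' - {p, r} - {q, s} = V" using fresh by auto
  then show "matchable E' (V' - {p, q} - {r, s})" "matchable E' (V' - {p, r} - {q, s})"
    using matchable_V by simp_all
qed

lemma new_ap:
  "matchable E' (V' - {q, b} - {a, p})" "matchable E' (V' - {c, r} - {a, p})"
  "matchable E' (V' - {s, d} - {a, p})" "matchable E' (V' - {r, s} - {a, p})"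
  "matchable E' (V' - {q, s} - {a, p})"
proof -
  note facts = new_edges corners fresh fresh_distinct corners_distinct
  have "matchable E (V - {a, b})" by (rule matchable_remove_edge[OF rail_edges(1)])
  then have "matchable E' ((V - {a, b}) \<union> {r, s})" by (intro lift_rs) auto
  moreover have "(V - {a, b}) \<union> {r, s} = V' - {q, b} - {a, p}" using facts by auto
  ultimately show "matchable E' (V' - {q, b} - {a, p})" by simp
  have "{a, b} \<inter> {c, d} = {}" using facts by auto
  then have "matchable E (V - {a, b} - {c, d})"
    by (intro matchable_remove_edges rail_edges)
  then have abcd: "matchable E' (V - {a, b} - {c, d})" by (rule lift0) auto
  have abcd': "matchable E' (insert b (insert q (V - {a, b} - {c, d})))"
    by (rule matchable_insert[OF abcd]) (use facts in \<open>auto simp: insert_commute\<close>)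
  show "matchable E' (V' - {c, r} - {a, p})"
    by (rule matchable_insert_eq[OF abcd', of s d]) (use facts in auto)
  show "matchable E' (V' - {s, d} - {a, p})"
    by (rule matchable_insert_eq[OF abcd', of c r]) (use facts in auto)
  \<comment> \<open>Here \<open>q b\<close> is forced and \<open>c\<close> has lost
    \<open>a\<close>, \<open>r\<close> and the rail to \<open>d\<close>, so it must be matched along
    a third old edge.\<close>
  obtain z where z: "{c, z} \<in> E" "z \<notin> {a, d}"
    using nbr_outside[OF three_nbrs[OF corners(3), of a d]] by blast
  have zb: "z \<noteq> b" "z \<noteq> c" "z \<in> V" using z rail_edges edgeD[of c z] by (auto simp: insert_commute)
  have zE: "{c, z} \<in> E'" using z zb corners_distinct by (intro old_edge) (auto simp: doubleton_eq_iff)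
  have "{a, b} \<inter> {c, z} = {}" using facts z zb by auto
  then have "matchable E (V - {a, b} - {c, z})"
    using z by (intro matchable_remove_edges rail_edges)
  then have abcz: "matchable E' (V - {a, b} - {c, z})" by (rule lift0) auto
  have abcz': "matchable E' (insert b (insert q (V - {a, b} - {c, z})))"
    by (rule matchable_insert[OF abcz]) (use facts in \<open>auto simp: insert_commute\<close>)
  show "matchable E' (V' - {r, s} - {a, p})"
    by (rule matchable_insert_eq[OF abcz' zE]) (use facts z zb in auto)
  have "matchable E (V - {a, c})" by (rule matchable_remove_edge[OF rail_edges(3)])
  then have ac: "matchable E' (V - {a, c})" by (rule lift0) auto
  show "matchable E' (V' - {q, s} - {a, p})"
    by (rule matchable_insert_eq[OF ac, of c r]) (use facts in auto)
qed

lemma edge_cases: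
  assumes "e \<in> E'"
  obtains "e \<in> E" "e \<noteq> {a, b}" "e \<noteq> {c, d}" | "e = {a, p}" | "e = {q, b}" | "e = {c, r}" | "e = {s, d}"
    | "e = {p, q}" | "e = {r, s}" | "e = {p, r}" | "e = {q, s}"
  using assms unfolding insert_rungs_def Un_iff Diff_iff insert_iff empty_iff by argo

lemma matchable_ap:
  assumes e: "e \<in> E'" "e \<inter> {a, p} = {}"
  shows "matchable E' (V' - e - {a, p})"
  using e(1)
proof (cases rule: edge_cases)
  case 1
  then show ?thesis using old_ap e(2) by blast
qed (use e(2) new_ap in auto)

lemma Diff_swap: "A - B - C = A - C - (B :: 'a set)"
  by blast

lemma matchable_corner:
  assumes e: "e \<in> E'" "e \<inter> f = {}" "f \<in> {{a, p}, {q, b}, {c, r}, {s, d}}"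
  shows "matchable E' (V' - e - f)"
proof -
  interpret R: ladder V E b a d c q p s r by (rule ladder_rev)
  interpret S: ladder V E c d a b r s p q by (rule ladder_swap)
  interpret T: ladder V E d c b a s r q p by (rule S.ladder_rev)
  have eq: "V \<union> {q, p, s, r} = V'" "V \<union> {r, s, p, q} = V'" "V \<union> {s, r, q, p} = V'" by auto
  have E: "insert_rungs E b a d c q p s r = E'" "insert_rungs E c d a b r s p q = E'"
    by (rule insert_rungs_rev, rule insert_rungs_swap)
  have E4: "insert_rungs E d c b a s r q p = E'"
    using insert_rungs_rev[of E d c b a s r q p] E(2) by simp
  show ?thesis
    using e matchable_ap[of e] R.matchable_ap[of e] S.matchable_ap[of e] T.matchable_ap[of e]
    unfolding E E4 eq by (auto simp: insert_commute)
qed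

lemma matchable_old_inner:
  assumes e: "e \<in> E" "e \<noteq> {a, b}" "e \<noteq> {c, d}" and f: "f \<in> {{p, q}, {r, s}, {p, r}, {q, s}}"
  shows "matchable E' (V' - e - f)"
proof -
  interpret R: ladder V E b a d c q p s r by (rule ladder_rev)
  interpret S: ladder V E c d a b r s p q by (rule ladder_swap)
  have eq: "V \<union> {q, p, s, r} = V'" "V \<union> {r, s, p, q} = V'" by auto
  have E: "insert_rungs E b a d c q p s r = E'" "insert_rungs E c d a b r s p q = E'"
    by (rule insert_rungs_rev insert_rungs_swap)+
  have "e \<noteq> {b, a}" "e \<noteq> {d, c}" using e by (auto simp: insert_commute)
  then have "matchable E' (V' - e - {q, s})" "matchable E' (V' - e - {r, s})"
    using R.old_inner(2)[of e] S.old_inner(1)[of e] e unfolding E eq by auto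
  then show ?thesis using old_inner[OF e] f by auto
qed

text \<open>Edges are sorted into those joining old to new vertices (\<open>K\<close>), those among
  new vertices (\<open>J\<close>) and surviving old ones; \<open>K\<close> absorbs most of the
  combinations.\<close>

lemma matchable_insert_rungs:
  assumes e: "e \<in> E'" and f: "f \<in> E'" and ef: "e \<inter> f = {}"
  shows "matchable E' (V' - e - f)"
proof -
  define K where "K = {{a, p}, {q, b}, {c, r}, {s, d}}"
  define J where "J = {{p, q}, {r, s}, {p, r}, {q, s}}"
  define O' where "O' = E - {{a, b}, {c, d}}"
  have old: "x \<in> E" "x \<noteq> {a, b}" "x \<noteq> {c, d}" if "x \<in> O'" for x
    using that by (simp_all add: O'_def)
  have cl: "x \<in> O' \<or> x \<in> K \<or> x \<in> J" if "x \<in> E'" for x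
    using that by (cases rule: edge_cases) (simp_all add: K_def J_def O'_def)
  have fe: "f \<inter> e = {}" using ef by auto
  consider "f \<in> K" | "e \<in> K" | "e \<in> O'" "f \<in> O'" | "e \<in> O'" "f \<in> J" | "f \<in> O'" "e \<in> J"
    | "e \<in> J" "f \<in> J"
    using cl[OF e] cl[OF f] by blast
  then show ?thesis
  proof cases
    case 1
    then show ?thesis unfolding K_def by (rule matchable_corner[OF e ef])
  next
    case 2
    then have "matchable E' (V' - f - e)" unfolding K_def by (rule matchable_corner[OF f fe])
    then show ?thesis by (simp only: Diff_swap[of V' e f])
  next
    case 3
    then have "matchable E (V - e - f)" using ef old(1) by (intro matchable_remove_edges)
    then have "matchable E' ((V - e - f) \<union> {p, q, r, s})" by (rule lift_all[rotated]) auto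
    moreover have "e \<subseteq> V" "f \<subseteq> V" using edge_sub old(1) 3 by simp_all
    then have "(V - e - f) \<union> {p, q, r, s} = V' - e - f"
      using fresh by blast
    ultimately show ?thesis by simp
  next
    case 4
    then show ?thesis unfolding J_def by (intro matchable_old_inner old)
  next
    case 5
    then have "matchable E' (V' - f - e)" unfolding J_def by (intro matchable_old_inner old)
    then show ?thesis by (simp only: Diff_swap[of V' e f])
  next
    case 6
    have ne: "x \<notin> f" if "x \<in> e" for x using that ef by blast
    have f: "f = {p, q} \<or> f = {r, s} \<or> f = {p, r} \<or> f = {q, s}"
      using 6(2) unfolding J_def insert_iff empty_iff by argo
    have V: "V' - {r, s} - {p, q} = V' - {p, q} - {r, s}" "V' - {q, s} - {p, r} = V' - {p, r} - {q, s}"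
      by (rule Diff_swap)+
    consider "e = {p, q}" | "e = {r, s}" | "e = {p, r}" | "e = {q, s}"
      using 6(1) unfolding J_def insert_iff empty_iff by argo
    then show ?thesis
    proof cases
      case 1
      then have "f = {r, s}" using ne[of p] ne[of q] f by (elim disjE) simp_all
      then show ?thesis using new_inner(1) 1 by (simp only:)
    next
      case 2
      then have "f = {p, q}" using ne[of r] ne[of s] f by (elim disjE) simp_all
      then show ?thesis using new_inner(1) 2 by (simp only: V)
    next
      case 3
      then have "f = {q, s}" using ne[of p] ne[of r] f by (elim disjE) simp_all
      then show ?thesis using new_inner(2) 3 by (simp only:)
    next
      case 4
      then have "f = {p, r}" using ne[of q] ne[of s] f by (elim disjE) simp_all
      then show ?thesis using new_inner(2) 4 by (simp only: V)
    qed
  qed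
qed

section \<open>Connectedness, colourings and size of the enlarged graph\<close>

lemma simple_insert_rungs: "simple_graph V' E'"
proof -
  have "e \<subseteq> V' \<and> card e = 2" if "e \<in> E'" for e
    using that
  proof (cases rule: edge_cases)
    case 1
    then show ?thesis using edge_sub edge_card by blast
  qed (use corners fresh fresh_distinct in \<open>auto simp: card_insert_if\<close>)
  then show ?thesis by (auto simp: simple_graph_def)
qed

lemma connected_insert_rungs: "connected_graph V' E'"
proof -
  let ?R = "{(x, y). {x, y} \<in> E'}"
  have "sym ?R" by (auto simp: sym_def insert_commute)
  then have symR: "(y, x) \<in> ?R\<^sup>*" if "(x, y) \<in> ?R\<^sup>*" for x y
    using that sym_rtrancl by (metis symD)
  have step: "(x, y) \<in> ?R\<^sup>*" if "{x, y} \<in> E'" for x y using that by auto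
  have ap: "(a, p) \<in> ?R\<^sup>*" and pq: "(p, q) \<in> ?R\<^sup>*" and qb: "(q, b) \<in> ?R\<^sup>*"
    and cr: "(c, r) \<in> ?R\<^sup>*" and rs: "(r, s) \<in> ?R\<^sup>*" and sd: "(s, d) \<in> ?R\<^sup>*" and pr: "(p, r) \<in> ?R\<^sup>*"
    by (rule step, rule new_edges)+
  have ab: "(a, b) \<in> ?R\<^sup>*" and cd: "(c, d) \<in> ?R\<^sup>*"
    by (rule rtrancl_trans[OF rtrancl_trans[OF ap pq] qb])
      (rule rtrancl_trans[OF rtrancl_trans[OF cr rs] sd])
  have E: "(x, y) \<in> ?R\<^sup>*" if "{x, y} \<in> E" for x y
  proof (cases "{x, y} = {a, b} \<or> {x, y} = {c, d}")
    case True
    then have "(x = a \<and> y = b) \<or> (x = b \<and> y = a) \<or> (x = c \<and> y = d) \<or> (x = d \<and> y = c)"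
      by (simp add: doubleton_eq_iff disj_ac)
    then show ?thesis using ab cd symR[OF ab] symR[OF cd] by (elim disjE conjE) (simp_all only:)
  next
    case False
    then show ?thesis by (intro step old_edge[OF that]) simp_all
  qed
  have aV: "(a, x) \<in> ?R\<^sup>*" if "x \<in> V" for x
  proof -
    have "(a, x) \<in> {(x, y). {x, y} \<in> E}\<^sup>*"
      using ext that corners by (auto simp: extendable_def connected_graph_def)
    then show ?thesis
    proof (induction rule: rtrancl_induct)
      case (step y z)
      then have "{y, z} \<in> E" by simp
      then show ?case by (rule rtrancl_trans[OF step.IH E])
    qed (rule rtrancl_refl)
  qed
  have ar: "(a, r) \<in> ?R\<^sup>*" by (rule rtrancl_trans[OF ap pr])
  have aV': "(a, x) \<in> ?R\<^sup>*" if "x \<in> V'" for x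
  proof -
    have "x \<in> V \<or> x = p \<or> x = q \<or> x = r \<or> x = s" using that by auto
    then show ?thesis
      using aV[of x] ap rtrancl_trans[OF ap pq] ar rtrancl_trans[OF ar rs]
      by (elim disjE) (simp_all only:)
  qed
  have "(x, y) \<in> ?R\<^sup>*" if "x \<in> V'" "y \<in> V'" for x y
    using symR[OF aV'[OF that(1)]] aV'[OF that(2)] by (rule rtrancl_trans)
  moreover have "V' \<noteq> {}" using corners(1) by blast
  ultimately show ?thesis unfolding connected_graph_def using simple_insert_rungs by blast
qed

lemma extendable_insert_rungs: "extendable 2 V' E'"
proof (rule extendableI[OF connected_insert_rungs])
  have "card V \<le> card V'" by (intro card_mono) auto
  then show "6 \<le> card V'" using card_V by simp
  show "{p, q} \<in> E'" "{r, s} \<in> E'" by (rule new_edges)+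
  show "{p, q} \<inter> {r, s} = {}" using fresh_distinct by auto
qed (rule matchable_insert_rungs)

text \<open>The path \<open>a p q b\<close> has odd length like the edge \<open>a b\<close>, so a
  2-colouring still separates \<open>a\<close> from \<open>b\<close>, and likewise \<open>c\<close>
  from \<open>d\<close>.\<close>

lemma nonbipartite_insert_rungs:
  assumes "\<not> bipartite V E"
  shows "\<not> bipartite V' E'"
proof
  assume "bipartite V' E'"
  from iffD1[OF bipartite_iff[OF simple_insert_rungs] this]
  obtain A where A: "\<forall>x y. {x, y} \<in> E' \<longrightarrow> (x \<in> A \<longleftrightarrow> y \<notin> A)" ..
  note flip = A[rule_format]
  have ab: "a \<in> A \<longleftrightarrow> b \<notin> A" and cd: "c \<in> A \<longleftrightarrow> d \<notin> A"
    using flip[OF new_edges(1)] flip[OF new_edges(2)] flip[OF new_edges(3)]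
      flip[OF new_edges(4)] flip[OF new_edges(5)] flip[OF new_edges(6)] by argo+
  have "x \<in> A \<longleftrightarrow> y \<notin> A" if "{x, y} \<in> E" for x y
  proof (cases "{x, y} = {a, b} \<or> {x, y} = {c, d}")
    case True
    then have "(x = a \<and> y = b) \<or> (x = b \<and> y = a) \<or> (x = c \<and> y = d) \<or> (x = d \<and> y = c)"
      by (simp add: doubleton_eq_iff disj_ac)
    then show ?thesis using ab cd by (elim disjE conjE) simp_all
  next
    case False
    then show ?thesis by (intro flip old_edge[OF that]) simp_all
  qed
  then have "bipartite V E" using iffD2[OF bipartite_iff[OF simple]] by blast
  then show False using assms by contradiction
qed

lemma card_V': "card V' = card V + 4"
  using fresh fresh_distinct by (simp add: card_insert_if)

lemma card_E': "card E' = card E + 6"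
proof -
  let ?N = "{{a, p}, {p, q}, {q, b}, {c, r}, {r, s}, {s, d}, {p, r}, {q, s}}"
  have ne: "a \<noteq> p" "a \<noteq> q" "a \<noteq> r" "a \<noteq> s" "b \<noteq> p" "b \<noteq> q" "b \<noteq> r" "b \<noteq> s"
    "c \<noteq> p" "c \<noteq> q" "c \<noteq> r" "c \<noteq> s" "d \<noteq> p" "d \<noteq> q" "d \<noteq> r" "d \<noteq> s"
    using corners fresh by auto
  have "card ?N = 8"
    using ne fresh_distinct corners_distinct by (simp add: doubleton_eq_iff)
  moreover have "e \<notin> E" if "e \<in> ?N" for e
  proof
    assume "e \<in> E"
    then have "e \<subseteq> V" by (rule edge_sub)
    then show False using that fresh by (elim insertE emptyE) simp_all
  qed
  then have "(E - {{a, b}, {c, d}}) \<inter> ?N = {}" by blast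
  then have "card E' = card (E - {{a, b}, {c, d}}) + card ?N"
    unfolding insert_rungs_def by (intro card_Un_disjoint) simp_all
  moreover have sub: "{{a, b}, {c, d}} \<subseteq> E" using rail_edges by simp
  moreover have "card {{a, b}, {c, d}} = 2"
    using corners_distinct by (simp add: doubleton_eq_iff)
  ultimately show ?thesis
    using card_Diff_subset[OF _ sub] card_mono[OF finE sub] by simp
qed

end

section \<open>Certified small graphs\<close>

definition graph_of :: "(nat \<times> nat) list \<Rightarrow> nat set set" where
  "graph_of es = (\<lambda>(x, y). {x, y}) ` set es"

text \<open>Kept as a list with repetitions: \<open>n\<close> distinct entries below
  \<open>n\<close> exhaust the vertices, so distinctness and length together express a perfect
  matching.\<close>

definition endpoints :: "(nat \<times> nat) list \<Rightarrow> nat list" where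
  "endpoints P = concat (map (\<lambda>(x, y). [x, y]) P)"

fun touching :: "nat \<times> nat \<Rightarrow> nat \<times> nat \<Rightarrow> bool" where
  "touching (a, b) (c, d) \<longleftrightarrow> a = c \<or> a = d \<or> b = c \<or> b = d"

text \<open>
  Every vertex \<open>v > 0\<close> having a smaller neighbour is what makes the graph connected.
\<close>

definition certificate :: "nat \<Rightarrow> (nat \<times> nat) list \<Rightarrow> (nat \<times> nat) list list \<Rightarrow> bool" where
  "certificate n es Ps \<longleftrightarrow>
     6 \<le> n \<and> Ps \<noteq> [] \<and>
     list_all (\<lambda>(x, y). x < y \<and> y < n) es \<and> distinct es \<and>
     list_all (\<lambda>v. list_ex (\<lambda>(x, y). y = v) es) [1..<n] \<and>
     list_all (\<lambda>P. list_all (\<lambda>e. e \<in> set es) P \<and> distinct (endpoints P) \<and>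
       length (endpoints P) = n) Ps \<and>
     list_all (\<lambda>e. let Qs = filter (\<lambda>P. e \<in> set P) Ps in
       list_all (\<lambda>f. touching e f \<or> list_ex (\<lambda>P. f \<in> set P) Qs) es) es"

lemma graph_ofI: "(x, y) \<in> set es \<Longrightarrow> {x, y} \<in> graph_of es"
  by (force simp: graph_of_def)

context
  fixes n es Ps
  assumes cert: "certificate n es Ps"
begin

lemma certD:
  shows "6 \<le> n" "Ps \<noteq> []" "distinct es" "\<forall>(x, y)\<in>set es. x < y \<and> y < n"
    and "\<forall>v\<in>set [1..<n]. \<exists>(x, y)\<in>set es. y = v"
    and "\<forall>P\<in>set Ps. set P \<subseteq> set es \<and> distinct (endpoints P) \<and> length (endpoints P) = n"
    and "\<forall>e\<in>set es. \<forall>f\<in>set es. touching e f \<or> (\<exists>P\<in>set Ps. e \<in> set P \<and> f \<in> set P)"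
  using cert
  by (simp_all only: certificate_def list_all_iff list_ex_iff Let_def set_filter mem_Collect_eq
      subset_eq) (elim conjE, (assumption | blast))+

lemma cert_edge: "(x, y) \<in> set es \<Longrightarrow> x < y \<and> y < n"
  using certD(4) by blast

lemma edge_in_graph_of: "e \<in> graph_of es \<Longrightarrow> \<exists>x y. (x, y) \<in> set es \<and> e = {x, y} \<and> x < y \<and> y < n"
  using cert_edge by (auto simp: graph_of_def)

lemma inj_graph_of: "inj_on (\<lambda>(x, y). {x, y}) (set es)"
proof (rule inj_onI)
  fix e f assume ef: "e \<in> set es" "f \<in> set es" "(\<lambda>(x, y). {x, y}) e = (\<lambda>(x, y). {x, y}) f"
  obtain a b c d where "e = (a, b)" "f = (c, d)" by fastforce
  then show "e = f" using ef cert_edge[of a b] cert_edge[of c d] by (auto simp: doubleton_eq_iff)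
qed

lemma card_graph_of: "card (graph_of es) = length es"
  using certD(3) card_image[OF inj_graph_of] by (simp add: graph_of_def distinct_card)

lemma simple_graph_of: "simple_graph {..<n} (graph_of es)"
  unfolding simple_graph_def using edge_in_graph_of by fastforce

lemma connected_graph_of: "connected_graph {..<n} (graph_of es)"
proof -
  let ?R = "{(x, y). {x, y} \<in> graph_of es}"
  have "sym ?R" by (auto simp: sym_def insert_commute)
  then have symR: "(y, x) \<in> ?R\<^sup>*" if "(x, y) \<in> ?R\<^sup>*" for x y
    using that sym_rtrancl by (metis symD)
  have from0: "v < n \<Longrightarrow> (0, v) \<in> ?R\<^sup>*" for v
  proof (induction v rule: less_induct)
    case (less v)
    show ?case
    proof (cases "v = 0")
      case False
      then have "v \<in> set [1..<n]" using less.prems by simp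
      then have "\<exists>(x, y)\<in>set es. y = v" using certD(5) by blast
      then obtain u where u: "(u, v) \<in> set es" by blast
      then have "u < v" "v < n" using cert_edge by auto
      then have "(0, u) \<in> ?R\<^sup>*" using less.IH by simp
      moreover have "(u, v) \<in> ?R" using graph_ofI[OF u] by simp
      ultimately show ?thesis by (rule rtrancl_into_rtrancl)
    qed simp
  qed
  have "(u, v) \<in> ?R\<^sup>*" if "u < n" "v < n" for u v
    using symR[OF from0[OF that(1)]] from0[OF that(2)] by (rule rtrancl_trans)
  moreover have "{..<n} \<noteq> {}" using certD(1) by (simp add: lessThan_empty_iff)
  ultimately show ?thesis unfolding connected_graph_def using simple_graph_of by blast
qed

lemma cert_perfect_matching:
  assumes P: "P \<in> set Ps"
  shows "perfect_matching {..<n} (graph_of es) (graph_of P)"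
proof -
  have sub: "set P \<subseteq> set es" and dist: "distinct (endpoints P)" and len: "length (endpoints P) = n"
    using certD(6) P by auto
  have U: "\<Union>(graph_of P) = set (endpoints P)"
    by (auto simp: graph_of_def endpoints_def)
  have "set (endpoints P) \<subseteq> {..<n}"
  proof -
    have "x < n \<and> y < n" if "(x, y) \<in> set P" for x y using cert_edge[of x y] sub that by auto
    then show ?thesis by (auto simp: endpoints_def)
  qed
  moreover have "card (set (endpoints P)) = n" using dist len by (simp add: distinct_card)
  ultimately have V: "set (endpoints P) = {..<n}" by (intro card_subset_eq) auto
  have "disjoint (graph_of Q)" if "distinct (endpoints Q)" for Q
    using that
  proof (induction Q)
    case Nil
    show ?case by (simp add: graph_of_def)
  next
    case (Cons e Q)
    obtain x y where e: "e = (x, y)" by fastforce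
    have eq: "graph_of (e # Q) = insert {x, y} (graph_of Q)" by (simp add: graph_of_def e)
    have "x \<notin> \<Union>(graph_of Q)" "y \<notin> \<Union>(graph_of Q)" "distinct (endpoints Q)"
      using Cons.prems by (auto simp: endpoints_def graph_of_def e)
    then show ?case unfolding eq using Cons.IH
      by (auto simp: disjoint_def)
  qed
  then show ?thesis
    using sub dist U V by (auto simp: perfect_matching_def matching_def graph_of_def)
qed

lemma extendable_graph_of: "extendable 2 {..<n} (graph_of es)"
proof -
  have ext: "matchable (graph_of es) ({..<n} - e - f)"
    if ef: "e \<in> graph_of es" "f \<in> graph_of es" "e \<inter> f = {}" for e f
  proof -
    obtain a b where ab: "(a, b) \<in> set es" "e = {a, b}" using edge_in_graph_of[OF ef(1)] by blast
    obtain c d where cd: "(c, d) \<in> set es" "f = {c, d}" using edge_in_graph_of[OF ef(2)] by blast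
    have "\<not> touching (a, b) (c, d)" using ef ab cd by auto
    then obtain P where P: "P \<in> set Ps" "(a, b) \<in> set P" "(c, d) \<in> set P"
      using certD(7) ab(1) cd(1) by blast
    have ePf: "e \<in> graph_of P" "f \<in> graph_of P" using graph_ofI P(2,3) ab(2) cd(2) by auto
    moreover have "e \<noteq> f" using ef(3) ab by auto
    ultimately have "f \<in> graph_of P - {e}" by simp
    then show ?thesis
      using perfect_matching_remove[OF perfect_matching_remove[OF cert_perfect_matching[OF P(1)] ePf(1)]]
      unfolding matchable_def by blast
  qed
  obtain P where P: "P \<in> set Ps" using certD(2) by (cases Ps) auto
  have pm: "perfect_matching {..<n} (graph_of es) (graph_of P)" by (rule cert_perfect_matching[OF P])
  interpret sgraph "{..<n}" "graph_of es" by unfold_locales (rule simple_graph_of)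
  obtain p where p: "\<And>v. v \<in> {..<n} \<Longrightarrow> {v, p v} \<in> graph_of P" "\<And>v. v \<in> {..<n} \<Longrightarrow> p v \<in> {..<n}"
    "\<And>v. v \<in> {..<n} \<Longrightarrow> p (p v) = v" "\<And>u v. {u, v} \<in> graph_of P \<Longrightarrow> p u = v" "inj_on p {..<n}"
    "\<And>v. v \<in> {..<n} \<Longrightarrow> {v, p v} \<in> graph_of es"
    by (rule perfect_matching_partner[OF pm]) blast
  \<comment> \<open>Two disjoint edges are found in one perfect matching: the edge at 0, and the
    edge at whichever of 1, 2 is not the partner of 0.\<close>
  have "\<exists>v\<in>{1, 2}. v \<noteq> p 0" by (cases "p 0 = 1") auto
  then obtain v where v: "v \<in> {1, 2}" "v \<noteq> p 0" by blast
  have vn: "v \<in> {..<n}" "0 \<in> {..<n}" using v certD(1) by auto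
  have "p v \<noteq> 0" using p(3)[OF vn(1)] v(2) by metis
  moreover have "p v \<noteq> p 0" using p(3)[OF vn(1)] p(3)[OF vn(2)] v(1) by fastforce
  ultimately have "{0, p 0} \<inter> {v, p v} = {}" using v by auto
  then show ?thesis
    using extendableI[OF connected_graph_of _ p(6)[OF vn(2)] p(6)[OF vn(1)]] ext certD(1) by auto
qed

end

text \<open>The vertices need not be distinct, so that triangles are covered as well.\<close>

lemma nonbipartite_5walk:
  assumes "simple_graph V E" "{a, b} \<in> E" "{b, c} \<in> E" "{c, d} \<in> E" "{d, e} \<in> E" "{e, a} \<in> E"
  shows "\<not> bipartite V E"
proof
  assume "bipartite V E"
  from iffD1[OF bipartite_iff[OF assms(1)] this]
  obtain A where A: "\<forall>x y. {x, y} \<in> E \<longrightarrow> (x \<in> A \<longleftrightarrow> y \<notin> A)" ..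
  show False
    using A[rule_format, OF assms(2)] A[rule_format, OF assms(3)] A[rule_format, OF assms(4)]
      A[rule_format, OF assms(5)] A[rule_format, OF assms(6)] by argo
qed

section \<open>Explicit graphs on 6 to 18 vertices\<close>

definition edges6 :: "(nat \<times> nat) list" where
  "edges6 =
    [(0, 1), (0, 2), (0, 3), (0, 4), (0, 5), (1, 2), (1, 3), (1, 4), (1, 5), (2, 3), (2, 4),
     (2, 5), (3, 4), (3, 5), (4, 5)]"

text \<open>All fifteen perfect matchings of the complete graph on six vertices.\<close>

definition matchings6 :: "(nat \<times> nat) list list" where
  "matchings6 =
    [[(0, 1), (2, 3), (4, 5)],
      [(0, 1), (2, 4), (3, 5)],
      [(0, 1), (2, 5), (3, 4)],
      [(0, 2), (1, 3), (4, 5)],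
      [(0, 2), (1, 4), (3, 5)],
      [(0, 2), (1, 5), (3, 4)],
      [(0, 3), (1, 2), (4, 5)],
      [(0, 3), (1, 4), (2, 5)],
      [(0, 3), (1, 5), (2, 4)],
      [(0, 4), (1, 2), (3, 5)],
      [(0, 4), (1, 3), (2, 5)],
      [(0, 4), (1, 5), (2, 3)],
      [(0, 5), (1, 2), (3, 4)],
      [(0, 5), (1, 3), (2, 4)],
      [(0, 5), (1, 4), (2, 3)]]"

lemma certificate6: "certificate 6 edges6 matchings6"
  unfolding certificate_def
  by (intro conjI) (simp_all add: edges6_def matchings6_def endpoints_def upt_rec)

text \<open>Two complete graphs, on 0 to 3 and on 4 to 7, joined by the perfect matching
  \<open>i, i + 4\<close>.\<close>

definition edges8 :: "(nat \<times> nat) list" where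
  "edges8 =
    [(0, 1), (0, 2), (0, 3), (0, 4), (1, 2), (1, 3), (1, 5), (2, 3), (2, 6), (3, 7), (4, 5),
     (4, 6), (4, 7), (5, 6), (5, 7), (6, 7)]"

definition matchings8 :: "(nat \<times> nat) list list" where
  "matchings8 =
    [[(0, 1), (2, 3), (4, 5), (6, 7)],
      [(0, 2), (1, 3), (4, 6), (5, 7)],
      [(0, 3), (1, 2), (4, 7), (5, 6)],
      [(0, 4), (1, 5), (2, 6), (3, 7)],
      [(0, 1), (2, 3), (4, 6), (5, 7)],
      [(0, 1), (2, 3), (4, 7), (5, 6)],
      [(0, 1), (2, 6), (3, 7), (4, 5)],
      [(0, 2), (1, 3), (4, 5), (6, 7)],
      [(0, 2), (1, 3), (4, 7), (5, 6)],
      [(0, 2), (1, 5), (3, 7), (4, 6)],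
      [(0, 3), (1, 2), (4, 5), (6, 7)],
      [(0, 3), (1, 2), (4, 6), (5, 7)],
      [(0, 3), (1, 5), (2, 6), (4, 7)],
      [(0, 4), (1, 2), (3, 7), (5, 6)],
      [(0, 4), (1, 3), (2, 6), (5, 7)],
      [(0, 4), (1, 5), (2, 3), (6, 7)]]"

lemma certificate8: "certificate 8 edges8 matchings8"
  unfolding certificate_def
  by (intro conjI) (simp_all add: edges8_def matchings8_def endpoints_def upt_rec)

text \<open>All degrees are 4 except at the adjacent cubic vertices 3 and 7.\<close>

definition edges10 :: "(nat \<times> nat) list" where
  "edges10 =
    [(0, 1), (0, 2), (0, 3), (0, 4), (1, 5), (1, 6), (1, 7), (2, 4), (2, 6), (2, 8), (3, 7),
     (3, 9), (4, 5), (4, 8), (5, 6), (5, 9), (6, 9), (7, 8), (8, 9)]"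

definition matchings10 :: "(nat \<times> nat) list list" where
  "matchings10 =
    [[(0, 1), (2, 4), (3, 7), (5, 6), (8, 9)],
      [(0, 1), (2, 6), (3, 9), (4, 5), (7, 8)],
      [(0, 2), (1, 5), (3, 7), (4, 8), (6, 9)],
      [(0, 3), (1, 6), (2, 4), (5, 9), (7, 8)],
      [(0, 3), (1, 7), (2, 8), (4, 5), (6, 9)],
      [(0, 2), (1, 7), (3, 9), (4, 8), (5, 6)],
      [(0, 4), (1, 6), (2, 8), (3, 7), (5, 9)],
      [(0, 2), (1, 6), (3, 7), (4, 5), (8, 9)],
      [(0, 3), (1, 7), (2, 6), (4, 8), (5, 9)],
      [(0, 4), (1, 5), (2, 6), (3, 7), (8, 9)],
      [(0, 3), (1, 5), (2, 4), (6, 9), (7, 8)],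
      [(0, 4), (1, 7), (2, 8), (3, 9), (5, 6)],
      [(0, 3), (1, 7), (2, 4), (5, 6), (8, 9)],
      [(0, 1), (2, 4), (3, 9), (5, 6), (7, 8)],
      [(0, 1), (2, 6), (3, 7), (4, 8), (5, 9)],
      [(0, 1), (2, 8), (3, 7), (4, 5), (6, 9)],
      [(0, 2), (1, 6), (3, 7), (4, 8), (5, 9)],
      [(0, 2), (1, 6), (3, 9), (4, 5), (7, 8)],
      [(0, 4), (1, 5), (2, 6), (3, 9), (7, 8)],
      [(0, 4), (1, 5), (2, 8), (3, 7), (6, 9)]]"

lemma certificate10: "certificate 10 edges10 matchings10"
  unfolding certificate_def
  by (intro conjI) (simp_all add: edges10_def matchings10_def endpoints_def upt_rec)

text \<open>Cubic except at 2, 6, 4, 7, which have degree 4 and form a 4-cycle in this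
  order.\<close>

definition edges12 :: "(nat \<times> nat) list" where
  "edges12 =
    [(0, 1), (0, 2), (0, 3), (1, 4), (1, 5), (2, 6), (2, 7), (2, 8), (3, 7), (3, 9), (4, 6),
     (4, 7), (4, 10), (5, 7), (5, 11), (6, 9), (6, 11), (8, 9), (8, 10), (10, 11)]"

definition matchings12 :: "(nat \<times> nat) list list" where
  "matchings12 =
    [[(0, 1), (2, 6), (3, 7), (4, 10), (5, 11), (8, 9)],
      [(0, 1), (2, 8), (3, 9), (4, 6), (5, 7), (10, 11)],
      [(0, 2), (1, 5), (3, 9), (4, 7), (6, 11), (8, 10)],
      [(0, 3), (1, 4), (2, 7), (5, 11), (6, 9), (8, 10)],
      [(0, 3), (1, 5), (2, 6), (4, 7), (8, 9), (10, 11)],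
      [(0, 2), (1, 5), (3, 7), (4, 6), (8, 9), (10, 11)],
      [(0, 3), (1, 5), (2, 7), (4, 10), (6, 11), (8, 9)],
      [(0, 3), (1, 4), (2, 8), (5, 7), (6, 9), (10, 11)],
      [(0, 1), (2, 7), (3, 9), (4, 6), (5, 11), (8, 10)],
      [(0, 1), (2, 8), (3, 7), (4, 10), (5, 11), (6, 9)],
      [(0, 2), (1, 4), (3, 9), (5, 7), (6, 11), (8, 10)],
      [(0, 1), (2, 6), (3, 9), (4, 7), (5, 11), (8, 10)],
      [(0, 1), (2, 8), (3, 9), (4, 10), (5, 7), (6, 11)],
      [(0, 2), (1, 4), (3, 7), (5, 11), (6, 9), (8, 10)],
      [(0, 3), (1, 4), (2, 6), (5, 7), (8, 9), (10, 11)],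
      [(0, 3), (1, 5), (2, 8), (4, 7), (6, 9), (10, 11)],
      [(0, 2), (1, 5), (3, 7), (4, 10), (6, 11), (8, 9)],
      [(0, 3), (1, 5), (2, 7), (4, 6), (8, 9), (10, 11)]]"

lemma certificate12: "certificate 12 edges12 matchings12"
  unfolding certificate_def
  by (intro conjI) (simp_all add: edges12_def matchings12_def endpoints_def upt_rec)

text \<open>Cubic, and any two vertices have at most one common neighbour, so there is no 4-cycle to
  insert rungs into.\<close>

definition edges14 :: "(nat \<times> nat) list" where
  "edges14 =
    [(0, 1), (0, 2), (0, 3), (1, 4), (1, 5), (2, 6), (2, 7), (3, 8), (3, 9), (4, 8), (4, 10),
     (5, 7), (5, 11), (6, 9), (6, 12), (7, 13), (8, 13), (9, 11), (10, 11), (10, 12), (12, 13)]"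

definition matchings14 :: "(nat \<times> nat) list list" where
  "matchings14 =
    [[(0, 1), (2, 6), (3, 8), (4, 10), (5, 7), (9, 11), (12, 13)],
      [(0, 2), (1, 4), (3, 8), (5, 11), (6, 9), (7, 13), (10, 12)],
      [(0, 3), (1, 5), (2, 7), (4, 8), (6, 9), (10, 11), (12, 13)],
      [(0, 1), (2, 7), (3, 9), (4, 10), (5, 11), (6, 12), (8, 13)],
      [(0, 2), (1, 4), (3, 9), (5, 7), (6, 12), (8, 13), (10, 11)],
      [(0, 3), (1, 5), (2, 6), (4, 8), (7, 13), (9, 11), (10, 12)],
      [(0, 2), (1, 5), (3, 8), (4, 10), (6, 12), (7, 13), (9, 11)],
      [(0, 1), (2, 6), (3, 9), (4, 8), (5, 11), (7, 13), (10, 12)],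
      [(0, 3), (1, 4), (2, 6), (5, 7), (8, 13), (9, 11), (10, 12)],
      [(0, 1), (2, 6), (3, 9), (4, 8), (5, 7), (10, 11), (12, 13)],
      [(0, 1), (2, 7), (3, 8), (4, 10), (5, 11), (6, 9), (12, 13)],
      [(0, 2), (1, 4), (3, 8), (5, 7), (6, 9), (10, 11), (12, 13)],
      [(0, 2), (1, 5), (3, 9), (4, 8), (6, 12), (7, 13), (10, 11)],
      [(0, 3), (1, 4), (2, 7), (5, 11), (6, 9), (8, 13), (10, 12)],
      [(0, 3), (1, 5), (2, 7), (4, 10), (6, 12), (8, 13), (9, 11)]]"

lemma certificate14: "certificate 14 edges14 matchings14"
  unfolding certificate_def
  by (intro conjI) (simp_all add: edges14_def matchings14_def endpoints_def upt_rec)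

definition edges16 :: "(nat \<times> nat) list" where
  "edges16 =
    [(0, 1), (0, 2), (0, 3), (1, 4), (1, 5), (2, 6), (2, 7), (3, 7), (3, 8), (4, 8), (4, 9),
     (5, 10), (5, 11), (6, 11), (6, 12), (7, 13), (8, 14), (9, 11), (9, 15), (10, 12), (10, 13),
     (12, 14), (13, 15), (14, 15)]"

definition matchings16 :: "(nat \<times> nat) list list" where
  "matchings16 =
    [[(0, 1), (2, 6), (3, 7), (4, 8), (5, 10), (9, 11), (12, 14), (13, 15)],
      [(0, 1), (2, 7), (3, 8), (4, 9), (5, 11), (6, 12), (10, 13), (14, 15)],
      [(0, 3), (1, 4), (2, 6), (5, 11), (7, 13), (8, 14), (9, 15), (10, 12)],
      [(0, 2), (1, 5), (3, 7), (4, 9), (6, 11), (8, 14), (10, 12), (13, 15)],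
      [(0, 3), (1, 5), (2, 7), (4, 8), (6, 11), (9, 15), (10, 13), (12, 14)],
      [(0, 2), (1, 4), (3, 8), (5, 10), (6, 12), (7, 13), (9, 11), (14, 15)],
      [(0, 3), (1, 4), (2, 7), (5, 10), (6, 12), (8, 14), (9, 11), (13, 15)],
      [(0, 2), (1, 4), (3, 7), (5, 11), (6, 12), (8, 14), (9, 15), (10, 13)],
      [(0, 3), (1, 5), (2, 6), (4, 8), (7, 13), (9, 11), (10, 12), (14, 15)],
      [(0, 2), (1, 4), (3, 8), (5, 10), (6, 11), (7, 13), (9, 15), (12, 14)],
      [(0, 1), (2, 6), (3, 8), (4, 9), (5, 11), (7, 13), (10, 12), (14, 15)],
      [(0, 2), (1, 5), (3, 7), (4, 8), (6, 12), (9, 11), (10, 13), (14, 15)],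
      [(0, 1), (2, 6), (3, 7), (4, 8), (5, 11), (9, 15), (10, 13), (12, 14)],
      [(0, 1), (2, 7), (3, 8), (4, 9), (5, 10), (6, 11), (12, 14), (13, 15)],
      [(0, 1), (2, 6), (3, 7), (4, 9), (5, 11), (8, 14), (10, 12), (13, 15)],
      [(0, 2), (1, 5), (3, 8), (4, 9), (6, 11), (7, 13), (10, 12), (14, 15)],
      [(0, 3), (1, 5), (2, 7), (4, 9), (6, 11), (8, 14), (10, 12), (13, 15)]]"

lemma certificate16: "certificate 16 edges16 matchings16"
  unfolding certificate_def
  by (intro conjI) (simp_all add: edges16_def matchings16_def endpoints_def upt_rec)

definition edges18 :: "(nat \<times> nat) list" where
  "edges18 =
    [(0, 1), (0, 2), (0, 3), (1, 4), (1, 5), (2, 6), (2, 7), (3, 4), (3, 8), (4, 9), (5, 10),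
     (5, 11), (6, 12), (6, 13), (7, 10), (7, 14), (8, 12), (8, 15), (9, 11), (9, 13), (10, 15),
     (11, 14), (12, 16), (13, 17), (14, 17), (15, 16), (16, 17)]"

definition matchings18 :: "(nat \<times> nat) list list" where
  "matchings18 =
    [[(0, 1), (2, 6), (3, 4), (5, 10), (7, 14), (8, 12), (9, 11), (13, 17), (15, 16)],
      [(0, 1), (2, 7), (3, 8), (4, 9), (5, 11), (6, 13), (10, 15), (12, 16), (14, 17)],
      [(0, 2), (1, 5), (3, 4), (6, 12), (7, 10), (8, 15), (9, 13), (11, 14), (16, 17)],
      [(0, 3), (1, 4), (2, 6), (5, 11), (7, 10), (8, 12), (9, 13), (14, 17), (15, 16)],
      [(0, 3), (1, 4), (2, 7), (5, 10), (6, 13), (8, 15), (9, 11), (12, 16), (14, 17)],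
      [(0, 2), (1, 4), (3, 8), (5, 11), (6, 12), (7, 14), (9, 13), (10, 15), (16, 17)],
      [(0, 3), (1, 5), (2, 7), (4, 9), (6, 13), (8, 12), (10, 15), (11, 14), (16, 17)],
      [(0, 1), (2, 7), (3, 8), (4, 9), (5, 10), (6, 12), (11, 14), (13, 17), (15, 16)],
      [(0, 3), (1, 5), (2, 6), (4, 9), (7, 10), (8, 15), (11, 14), (12, 16), (13, 17)],
      [(0, 2), (1, 5), (3, 4), (6, 13), (7, 10), (8, 12), (9, 11), (14, 17), (15, 16)],
      [(0, 1), (2, 6), (3, 4), (5, 11), (7, 10), (8, 15), (9, 13), (12, 16), (14, 17)],
      [(0, 1), (2, 6), (3, 8), (4, 9), (5, 11), (7, 14), (10, 15), (12, 16), (13, 17)],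
      [(0, 1), (2, 7), (3, 4), (5, 10), (6, 12), (8, 15), (9, 13), (11, 14), (16, 17)],
      [(0, 2), (1, 4), (3, 8), (5, 10), (6, 12), (7, 14), (9, 11), (13, 17), (15, 16)],
      [(0, 2), (1, 5), (3, 4), (6, 13), (7, 14), (8, 12), (9, 11), (10, 15), (16, 17)],
      [(0, 2), (1, 5), (3, 8), (4, 9), (6, 12), (7, 10), (11, 14), (13, 17), (15, 16)],
      [(0, 3), (1, 4), (2, 6), (5, 10), (7, 14), (8, 15), (9, 11), (12, 16), (13, 17)],
      [(0, 3), (1, 4), (2, 7), (5, 10), (6, 12), (8, 15), (9, 13), (11, 14), (16, 17)],
      [(0, 1), (2, 6), (3, 4), (5, 11), (7, 14), (8, 12), (9, 13), (10, 15), (16, 17)],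
      [(0, 2), (1, 4), (3, 8), (5, 11), (6, 12), (7, 10), (9, 13), (14, 17), (15, 16)],
      [(0, 2), (1, 5), (3, 4), (6, 13), (7, 10), (8, 15), (9, 11), (12, 16), (14, 17)]]"

lemma certificate18: "certificate 18 edges18 matchings18"
  unfolding certificate_def
  by (intro conjI) (simp_all add: edges18_def matchings18_def endpoints_def upt_rec)

lemma certificate_witness:
  assumes "certificate n es Ps" "length es = m" "{a, b} \<in> graph_of es" "{b, c} \<in> graph_of es"
    "{c, d} \<in> graph_of es" "{d, e} \<in> graph_of es" "{e, a} \<in> graph_of es"
  shows "extendable 2 {..<n} (graph_of es)" "\<not> bipartite {..<n} (graph_of es)"
    "card (graph_of es) = m"
proof -
  show "extendable 2 {..<n} (graph_of es)" by (rule extendable_graph_of[OF assms(1)])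
  show "\<not> bipartite {..<n} (graph_of es)"
    by (rule nonbipartite_5walk[OF simple_graph_of[OF assms(1)] assms(3-7)])
  show "card (graph_of es) = m" using card_graph_of[OF assms(1)] assms(2) by simp
qed

text \<open>The odd closed walk \<open>0 1 0 1 2\<close> is the triangle on 0, 1, 2 with one edge
  traversed back and forth. On 8 and 10 vertices triangles serve likewise, from 12 on genuine
  5-cycles.\<close>

lemma witness6:
  "extendable 2 {..<6} (graph_of edges6)" "\<not> bipartite {..<6} (graph_of edges6)"
  "card (graph_of edges6) = 15"
  by (rule certificate_witness[OF certificate6, of 15 0 1 0 1 2];
      simp add: graph_of_def edges6_def insert_commute)+

lemma witness8:
  "extendable 2 {..<8} (graph_of edges8)" "\<not> bipartite {..<8} (graph_of edges8)"
  "card (graph_of edges8) = 16"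
  by (rule certificate_witness[OF certificate8, of 16 0 1 0 1 2];
      simp add: graph_of_def edges8_def insert_commute)+

lemma witness10:
  "extendable 2 {..<10} (graph_of edges10)" "\<not> bipartite {..<10} (graph_of edges10)"
  "card (graph_of edges10) = 19"
  by (rule certificate_witness[OF certificate10, of 19 0 1 0 2 4];
      simp add: graph_of_def edges10_def insert_commute)+

lemma witness12:
  "extendable 2 {..<12} (graph_of edges12)" "\<not> bipartite {..<12} (graph_of edges12)"
  "card (graph_of edges12) = 20"
  by (rule certificate_witness[OF certificate12, of 20 0 1 4 6 2];
      simp add: graph_of_def edges12_def insert_commute)+

lemma witness14:
  "extendable 2 {..<14} (graph_of edges14)" "\<not> bipartite {..<14} (graph_of edges14)"
  "card (graph_of edges14) = 21"
  by (rule certificate_witness[OF certificate14, of 21 0 1 4 8 3];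
      simp add: graph_of_def edges14_def insert_commute)+

lemma witness16:
  "extendable 2 {..<16} (graph_of edges16)" "\<not> bipartite {..<16} (graph_of edges16)"
  "card (graph_of edges16) = 24"
  by (rule certificate_witness[OF certificate16, of 24 0 1 4 8 3];
      simp add: graph_of_def edges16_def insert_commute)+

lemma witness18:
  "extendable 2 {..<18} (graph_of edges18)" "\<not> bipartite {..<18} (graph_of edges18)"
  "card (graph_of edges18) = 27"
  by (rule certificate_witness[OF certificate18, of 27 1 4 9 11 5];
      simp add: graph_of_def edges18_def insert_commute)+

section \<open>The minimum size\<close>

lemma min_edges_eqI:
  fixes V :: "nat set"
  assumes "extendable k V E" "\<not> bipartite V E"
    and "\<And>V' E' :: nat set set. extendable k V' E' \<Longrightarrow> \<not> bipartite V' E' \<Longrightarrow> card V' = card V \<Longrightarrow> card E \<le> card E'"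
  shows "min_edges (card V) k = enat (card E)"
  unfolding min_edges_def
  by (rule antisym; (rule Inf_lower Inf_greatest)) (use assms in auto)

text \<open>The invariant of the induction: besides having the optimal size, the graph offers a
  chordless 4-cycle for the next insertion. Doubling avoids a division.\<close>

definition laddered :: "nat \<Rightarrow> bool" where
  "laddered n \<longleftrightarrow> (\<exists>(V :: nat set) E a b c d.
     extendable 2 V E \<and> \<not> bipartite V E \<and> card V = n \<and> 2 * card E = 3 * n \<and>
     {a, b} \<in> E \<and> {c, d} \<in> E \<and> {a, c} \<in> E \<and> {b, d} \<in> E \<and> {a, d} \<notin> E \<and> {b, c} \<notin> E \<and>
     distinct [a, b, c, d])"

text \<open>The insertion creates a new chordless 4-cycle \<open>a p r c\<close>, so it can be
  repeated.\<close>

lemma laddered_add4: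
  assumes "laddered n"
  shows "laddered (n + 4)"
proof -
  obtain V :: "nat set" and E a b c d where ext: "extendable 2 V E" and nb: "\<not> bipartite V E"
    and card: "card V = n" "2 * card E = 3 * n"
    and sq: "{a, b} \<in> E" "{c, d} \<in> E" "{a, c} \<in> E" "{b, d} \<in> E" "{a, d} \<notin> E" "{b, c} \<notin> E"
      "distinct [a, b, c, d]"
    using assms unfolding laddered_def by blast
  interpret ext2 V E by unfold_locales (rule ext)
  obtain m where m: "\<And>v. v \<in> V \<Longrightarrow> v < m"
    using finV unfolding finite_nat_set_iff_bounded by blast
  have V: "a < m" "b < m" "c < m" "d < m" "a \<in> V" "b \<in> V" "c \<in> V" "d \<in> V"
    using edgeD[OF sq(1)] edgeD[OF sq(2)] m by auto
  \<comment> \<open>As \<open>m\<close> exceeds every vertex, these four numbers are fresh.\<close>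
  define p q r s where "p = m" and "q = m + 1" and "r = m + 2" and "s = m + 3"
  have fresh: "{p, q, r, s} \<inter> V = {}" using m by (fastforce simp: p_def q_def r_def s_def)
  have dist: "distinct [a, b, c, d, p, q, r, s]"
    using sq(7) V by (auto simp: p_def q_def r_def s_def)
  interpret ladder V E a b c d p q r s
    by unfold_locales (use sq V fresh dist in \<open>auto simp: rung_frame_def\<close>)
  \<comment> \<open>The possible chords of the new 4-cycle each have a new vertex as an end, so they
    are not old edges, and they are not among the eight added ones.\<close>
  have "{a, r} \<notin> E" "{p, c} \<notin> E" using edgeD[of a r] edgeD[of p c] fresh by auto
  then have "{a, r} \<notin> E'" "{p, c} \<notin> E'"
    using dist by (auto simp: insert_rungs_def doubleton_eq_iff)
  moreover have "2 * card E' = 3 * card V'" using card by (simp add: card_E' card_V' del: Un_insert_right)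
  moreover have "distinct [a, p, c, r]" using dist by auto
  ultimately show ?thesis
    unfolding laddered_def
    by (intro exI[of _ V'] exI[of _ E'] exI[of _ a] exI[of _ p] exI[of _ c] exI[of _ r])
      (use extendable_insert_rungs nonbipartite_insert_rungs[OF nb] card card_V' new_edges in simp)
qed

lemma laddered_add: "laddered n \<Longrightarrow> laddered (n + 4 * k)"
proof (induction k)
  case (Suc k)
  then show ?case using laddered_add4[of "n + 4 * k"] by (simp add: ac_simps)
qed simp

lemma laddered_16: "laddered 16"
  unfolding laddered_def
  by (intro exI[of _ "{..<16}"] exI[of _ "graph_of edges16"]
      exI[of _ 0] exI[of _ 2] exI[of _ 3] exI[of _ 7] conjI witness16)
    (simp_all add: witness16 graph_of_def edges16_def doubleton_eq_iff)

lemma laddered_18: "laddered 18"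
  unfolding laddered_def
  by (intro exI[of _ "{..<18}"] exI[of _ "graph_of edges18"]
      exI[of _ 0] exI[of _ 1] exI[of _ 3] exI[of _ 4] conjI witness18)
    (simp_all add: witness18 graph_of_def edges18_def doubleton_eq_iff)

theorem theorem3p2:
  fixes \<nu> :: nat
  assumes "even \<nu>" and "\<nu> \<ge> 6"
  shows "min_edges \<nu> 2 =
    (if \<nu> = 6 then 15
     else if \<nu> = 8 then 16
     else if \<nu> = 10 then 19
     else if \<nu> = 12 then 20
     else enat (3 * \<nu> div 2))"
proof -
  have nb: "nonbip_ext2 V E" if "extendable 2 V E" "\<not> bipartite V E" "card V = \<nu>"
    for V :: "nat set" and E
    using that assms(1) by unfold_locales simp_all
  have eq: "min_edges \<nu> 2 = enat m"
    if "extendable 2 V E" "\<not> bipartite V E" "card V = \<nu>" "card E = m"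
      and "\<And>V E :: nat set set. nonbip_ext2 V E \<Longrightarrow> card V = \<nu> \<Longrightarrow> m \<le> card E"
    for V :: "nat set" and E m
    using min_edges_eqI[OF that(1,2)] that(3-5) nb by blast
  have "min_edges \<nu> 2 = 15" if \<nu>: "\<nu> = 6"
  proof -
    have "min_edges \<nu> 2 = enat 15"
      by (rule eq[OF witness6(1,2)])
        (use \<nu> nonbip_ext2.size_ge_6 in \<open>auto simp: witness6(3)\<close>)
    then show ?thesis by (simp add: numeral_eq_enat)
  qed
  moreover
  have "min_edges \<nu> 2 = 16" if \<nu>: "\<nu> = 8"
  proof -
    have "min_edges \<nu> 2 = enat 16"
      by (rule eq[OF witness8(1,2)])
        (use \<nu> nonbip_ext2.size_ge_8 in \<open>auto simp: witness8(3)\<close>)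
    then show ?thesis by (simp add: numeral_eq_enat)
  qed
  moreover
  have "min_edges \<nu> 2 = 19" if \<nu>: "\<nu> = 10"
  proof -
    have "min_edges \<nu> 2 = enat 19"
      by (rule eq[OF witness10(1,2)])
        (use \<nu> nonbip_ext2.size_ge_10 in \<open>auto simp: witness10(3)\<close>)
    then show ?thesis by (simp add: numeral_eq_enat)
  qed
  moreover
  have "min_edges \<nu> 2 = 20" if \<nu>: "\<nu> = 12"
  proof -
    have "min_edges \<nu> 2 = enat 20"
      by (rule eq[OF witness12(1,2)])
        (use \<nu> nonbip_ext2.size_ge_12 in \<open>auto simp: witness12(3)\<close>)
    then show ?thesis by (simp add: numeral_eq_enat)
  qed
  moreover
  have "min_edges \<nu> 2 = enat (3 * \<nu> div 2)" if "\<nu> \<ge> 14"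
  proof -
    have bound: "3 * \<nu> div 2 \<le> card E" if "nonbip_ext2 V E" "card V = \<nu>"
      for V :: "nat set" and E
      using nonbip_ext2.size_ge[OF that(1)] that(2) by simp
    show ?thesis
    proof (cases "\<nu> = 14")
      case True
      then show ?thesis
        using eq[OF witness14(1,2) _ _ bound] witness14(3) by simp
    next
      case False
      obtain j where j: "\<nu> = 2 * j" using assms(1) by (rule evenE)
      \<comment> \<open>Insertions preserve the residue modulo 4, so 16 and 18 start one class each.
        With 14 excluded, \<open>i \<ge> 4\<close> in both cases below and \<open>i - 4\<close> is
        not truncated.\<close>
      obtain k where "\<nu> = 16 + 4 * k \<or> \<nu> = 18 + 4 * k"
      proof (cases "even j")
        case True
        then obtain i where "j = 2 * i" by (rule evenE)
        then have "\<nu> = 16 + 4 * (i - 4)" using j \<open>\<nu> \<ge> 14\<close> by arith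
        then show ?thesis using that by blast
      next
        case odd: False
        then obtain i where "j = 2 * i + 1" by (rule oddE)
        then have "\<nu> = 18 + 4 * (i - 4)" using j \<open>\<nu> \<ge> 14\<close> False by arith
        then show ?thesis using that by blast
      qed
      then have "laddered \<nu>"
        using laddered_add[OF laddered_16] laddered_add[OF laddered_18] by auto
      then obtain V :: "nat set" and E where VE: "extendable 2 V E" "\<not> bipartite V E"
          "card V = \<nu>" "2 * card E = 3 * \<nu>"
        unfolding laddered_def by blast
      then have "card E = 3 * \<nu> div 2" by simp
      then show ?thesis by (rule eq[OF VE(1-3)]) (rule bound)
    qed
  qed
  moreover have "\<nu> = 6 \<or> \<nu> = 8 \<or> \<nu> = 10 \<or> \<nu> = 12 \<or> \<nu> \<ge> 14"
    using assms by presburger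
  ultimately show ?thesis by auto
qed

end
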